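(* Let $\varepsilon>0$. For $\lambda>0$ and integers $n\ge\lambda$, let $M_{n,\lambda/n}$ be the adjacency matrix of the Erdős–Rényi random graph $G(n,\lambda/n)$. Then there exist (random) orthonormal bases $\{u_i(M_{n,\lambda/n})\}_{i=1}^n$ of $\mathbb{R}^n$, where $u_i(M_{n,\lambda/n})$ is a unit eigenvector of $M_{n,\lambda/n}$ corresponding to its $i$-th smallest eigenvalue $\Lambda_i(M_{n,\lambda/n})$, such that, with $$U(n,\lambda,\varepsilon):=\{i\in\{1,2,\dots,n\}:\ \|u_i(M_{n,\lambda/n})\|_\infty<\varepsilon\},$$ one has $$\liminf_{\lambda\to\infty}\ \liminf_{n\to\infty}\ \frac{|U(n,\lambda,\varepsilon)|}{n}=1\quad\text{almost surely};$$ that is, for every deterministic sequence $\lambda_m\to\infty$, almost surely $\liminf_{m\to\infty}\liminf_{n\to\infty}|U(n,\lambda_m,\varepsilon)|/n=1$.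
   Context: For $p\in[0,1]$, $M_{n,p}$ is the adjacency matrix of the Erdős–Rényi graph $G(n,p)$: the random symmetric $n\times n$ matrix with zero diagonal whose entries $M_{n,p}(i,j)$, $i>j$, are independent and equal to $1$ with probability $p$ and $0$ with probability $1-p$. All random matrices are defined on a common probability space. For a real symmetric $n\times n$ matrix $H$, its eigenvalues (with multiplicity) are ordered as $\Lambda_1(H)\le\Lambda_2(H)\le\cdots\le\Lambda_n(H)$. $\|\cdot\|_\infty$ is the maximum absolute value of the coordinates. *)

theory Defs
  imports "HOL-Probability.Probability" "Jordan_Normal_Form.Char_Poly" "Jordan_Normal_Form.VS_Connect"
begin

unbundle no vec_syntax
unbundle no inner_syntax

text \<open>
  Rows, columns and coordinates are indexed from 0, as in \<^typ>\<open>real mat\<close> and \<^typ>\<open>real vec\<close>;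
  eigenvalues and eigenvectors are indexed from 1.
\<close>

text \<open>
  \<open>A\<close> is a random variable on \<open>P\<close> distributed as the adjacency matrix of \<open>G(n,p)\<close>. Being the
  adjacency matrix of a simple graph is required for every outcome.
  The events \<open>{A = 1}\<close> and \<open>{A = 0}\<close> below are measurable because \<open>indep_vars\<close> includes
  measurability of the entries.
\<close>
definition erdos_renyi_adj :: "'w measure \<Rightarrow> nat \<Rightarrow> real \<Rightarrow> ('w \<Rightarrow> real mat) \<Rightarrow> bool" where
  "erdos_renyi_adj P n p A \<longleftrightarrow>
     (\<forall>\<omega>\<in>space P. A \<omega> \<in> carrier_mat n n \<and>
        (\<forall>i<n. A \<omega> $$ (i, i) = 0) \<and>
        (\<forall>i<n. \<forall>j<n. A \<omega> $$ (i, j) \<in> {0, 1} \<and> A \<omega> $$ (i, j) = A \<omega> $$ (j, i))) \<and>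
     prob_space.indep_vars P (\<lambda>_. borel) (\<lambda>ij \<omega>. A \<omega> $$ ij) {(i, j). j < i \<and> i < n} \<and>
     (\<forall>i<n. \<forall>j<i. measure P {\<omega>\<in>space P. A \<omega> $$ (i, j) = 1} = p \<and>
                  measure P {\<omega>\<in>space P. A \<omega> $$ (i, j) = 0} = 1 - p)"

text \<open>
  \<open>eig i H\<close> is the \<open>i\<close>-th smallest eigenvalue (\<open>1 \<le> i \<le> n\<close>) of a real symmetric \<open>n \<times> n\<close> matrix \<open>H\<close>,
  counted with multiplicity; the characteristic polynomial of such an \<open>H\<close> has \<open>n\<close> real roots.
\<close>
definition eig :: "nat \<Rightarrow> real mat \<Rightarrow> real" where
  "eig i H = sorted_list_of_multiset (proots (char_poly H)) ! (i - 1)"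

definition sup_norm :: "real vec \<Rightarrow> real" where
  "sup_norm v = Max ((\<lambda>k. \<bar>v $ k\<bar>) ` {..<dim_vec v})"

definition orthonormal_basis :: "nat \<Rightarrow> (nat \<Rightarrow> real vec) \<Rightarrow> bool" where
  "orthonormal_basis n u \<longleftrightarrow>
     vectorspace.basis class_ring (module_vec TYPE(real) n) (u ` {1..n}) \<and>
     (\<forall>i\<in>{1..n}. \<forall>j\<in>{1..n}. u i \<bullet> u j = (if i = j then 1 else 0))"

definition ordered_eigenbasis :: "nat \<Rightarrow> real mat \<Rightarrow> (nat \<Rightarrow> real vec) \<Rightarrow> bool" where
  "ordered_eigenbasis n H u \<longleftrightarrow>
     orthonormal_basis n u \<and> (\<forall>i\<in>{1..n}. eigenvector H (u i) (eig i H))"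

text \<open>Randomness of the basis means that every coordinate of every basis vector is a random variable.\<close>
definition random_ordered_eigenbasis ::
    "'w measure \<Rightarrow> nat \<Rightarrow> ('w \<Rightarrow> real mat) \<Rightarrow> ('w \<Rightarrow> nat \<Rightarrow> real vec) \<Rightarrow> bool" where
  "random_ordered_eigenbasis P n A u \<longleftrightarrow>
     (\<forall>i\<in>{1..n}. \<forall>k<n. (\<lambda>\<omega>. u \<omega> i $ k) \<in> borel_measurable P) \<and>
     (\<forall>\<omega>\<in>space P. ordered_eigenbasis n (A \<omega>) (u \<omega>))"

definition delocalized :: "nat \<Rightarrow> real \<Rightarrow> (nat \<Rightarrow> real vec) \<Rightarrow> nat set" where
  "delocalized n \<epsilon> u = {i\<in>{1..n}. sup_norm (u i) < \<epsilon>}"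

end

theory Submission
  imports Defs "Jordan_Normal_Form.Schur_Decomposition"
begin

text \<open>
  Every ordered eigenbasis works. Let \<open>k\<close> be a vertex of \<open>G(n, \<lambda>/n)\<close> whose ball of radius \<open>d\<close> is a tree
  in which all degrees are close to \<open>\<lambda>\<close>. If \<open>A u = \<Lambda> u\<close> and \<open>S j\<close> is the sum of \<open>u\<close> over the sphere of
  radius \<open>j\<close> about \<open>k\<close>, then \<open>g j = S j / \<lambda>\<^bsup>j/2\<^esup>\<close> almost satisfies the Chebyshev recurrence
  \<open>x g j = g (j+1) + g (j-1)\<close> with \<open>x = \<Lambda> / \<lambda>\<^bsup>1/2\<^esup>\<close>, and \<open>\<Sum>j\<le>d. (g j)\<^sup>2 \<le> 3\<close> by Cauchy-Schwarz. For \<open>\<bar>x\<bar> \<le> 2\<close>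
  the energy \<open>(g j)\<^sup>2 + (g (j+1))\<^sup>2 - x g j g (j+1)\<close> is nearly conserved, for \<open>\<bar>x\<bar> > 2\<close> the sequence
  \<open>\<bar>g j\<bar>\<close> does not decrease; either way \<open>(u k)\<^sup>2 = (g 0)\<^sup>2\<close> is of order \<open>1/d\<close>. Since \<open>\<Sum>i. (u i k)\<^sup>2 = 1\<close>, each
  remaining vertex spoils at most \<open>1/\<epsilon>\<^sup>2\<close> eigenvectors.

  The remaining vertices have a vertex of atypical degree nearby, or a short cycle nearby and only
  typical degrees. The former are controlled by the sum of all atypical degrees: splitting each
  degree into its contributions from below and above the diagonal gives two families that are
  independent over the vertices, so a Chernoff bound applies. For the latter it suffices, because
  balls are bounded, to count pairs of disjoint short cycles with tails, whose expected number is
  bounded in \<open>n\<close> by independence; Markov's inequality then gives probabilities of order \<open>n\<^sup>-\<^sup>2\<close>.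
  Both bounds are summable in \<open>n\<close>, so Borel-Cantelli applies whatever the coupling of different \<open>n\<close>.
\<close>

subsection \<open>The perturbed Chebyshev recurrence\<close>

text \<open>The quadratic form is invariant under the exact recurrence \<open>c = x * b - a\<close>;
  a defect \<open>e\<close> enters only through the product \<open>e * (a - c)\<close>.\<close>

lemma energy_step:
  fixes a b c x e :: real
  assumes "x * b = c + a + e"
  shows "(b\<^sup>2 + c\<^sup>2 - x * b * c) - (a\<^sup>2 + b\<^sup>2 - x * a * b) = e * (a - c)"
proof -
  have "x * b * c = (c + a + e) * c" "x * a * b = (c + a + e) * a"
    using assms by (simp_all add: algebra_simps)
  then show ?thesis by (simp add: algebra_simps power2_eq_square)
qed

text \<open>The start condition acts like a value 0 at index -1 and makes the initial energy exactly
  \<open>(g 0)\<^sup>2\<close>. As the values are at most 2 in modulus, each use of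
  \<open>energy_step\<close> loses at most \<open>4 * \<delta>\<close>.\<close>

lemma energy_drift:
  fixes g :: "nat \<Rightarrow> real" and x \<delta> :: real
  assumes rec: "\<And>j. 1 \<le> j \<Longrightarrow> j < d \<Longrightarrow> \<bar>x * g j - g (j+1) - g (j-1)\<bar> \<le> \<delta>"
    and g1: "g 1 = x * g 0"
    and bound: "\<And>j. j \<le> d \<Longrightarrow> \<bar>g j\<bar> \<le> 2"
    and "j < d" "0 \<le> \<delta>"
  shows "(g 0)\<^sup>2 - 4 * \<delta> * j \<le> (g j)\<^sup>2 + (g (j+1))\<^sup>2 - x * g j * g (j+1)"
  using \<open>j < d\<close>
proof (induction j)
  case 0
  then show ?case by (simp add: g1 power2_eq_square algebra_simps flip: One_nat_def)
next
  case (Suc j)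
  define e where "e = x * g (Suc j) - g (Suc j + 1) - g j"
  have e: "\<bar>e\<bar> \<le> \<delta>" using rec[of "Suc j"] Suc.prems by (simp add: e_def)
  have diff: "\<bar>g j - g (j+2)\<bar> \<le> 4"
    using bound[of j] bound[of "j+2"] Suc.prems by (auto simp: abs_if split: if_splits)
  have "\<bar>e * (g j - g (j+2))\<bar> \<le> \<delta> * 4"
    unfolding abs_mult using e diff \<open>0 \<le> \<delta>\<close> by (intro mult_mono) auto
  moreover have "((g (Suc j))\<^sup>2 + (g (j+2))\<^sup>2 - x * g (Suc j) * g (j+2))
      - ((g j)\<^sup>2 + (g (Suc j))\<^sup>2 - x * g j * g (Suc j)) = e * (g j - g (j+2))"
    by (rule energy_step) (simp add: e_def)
  moreover have "(g 0)\<^sup>2 - 4 * \<delta> * real j \<le> (g j)\<^sup>2 + (g (Suc j))\<^sup>2 - x * g j * g (Suc j)"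
    using Suc by simp
  ultimately show ?case by (simp add: algebra_simps abs_if split: if_splits)
qed

lemma sq_form_le:
  fixes a b x :: real
  assumes "\<bar>x\<bar> \<le> 2"
  shows "a\<^sup>2 + b\<^sup>2 - x * a * b \<le> 2 * (a\<^sup>2 + b\<^sup>2)"
proof -
  have "- (x * (a * b)) \<le> \<bar>x\<bar> * \<bar>a * b\<bar>" by (metis abs_ge_minus_self abs_mult)
  also have "\<dots> \<le> 2 * \<bar>a * b\<bar>" using assms by (intro mult_right_mono) auto
  also have "\<dots> \<le> a\<^sup>2 + b\<^sup>2" using sum_squares_bound[of "\<bar>a\<bar>" "\<bar>b\<bar>"] by (simp add: abs_mult)
  finally show ?thesis by (simp add: algebra_simps)
qed

text \<open>For \<open>\<bar>x\<bar> \<ge> 2\<close> the modulus is nearly convex: each increment of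
  \<open>\<bar>g j\<bar>\<close> falls below the preceding one by at most \<open>\<delta>\<close>.
  The first increment is at least \<open>\<bar>g 0\<bar>\<close>, so none turns negative within
  \<open>d\<close> steps.\<close>

lemma growth_outside:
  fixes g :: "nat \<Rightarrow> real" and x \<delta> :: real
  assumes rec: "\<And>j. 1 \<le> j \<Longrightarrow> j < d \<Longrightarrow> \<bar>x * g j - g (j+1) - g (j-1)\<bar> \<le> \<delta>"
    and g1: "g 1 = x * g 0"
    and x: "\<bar>x\<bar> \<ge> 2" and \<delta>: "0 \<le> \<delta>" "\<delta> * d \<le> \<bar>g 0\<bar>"
    and "j < d"
  shows "\<bar>g (Suc j)\<bar> - \<bar>g j\<bar> \<ge> \<bar>g 0\<bar> - \<delta> * j \<and> \<bar>g (Suc j)\<bar> \<ge> \<bar>g 0\<bar>"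
  using \<open>j < d\<close>
proof (induction j)
  case 0
  have "2 * \<bar>g 0\<bar> \<le> \<bar>x\<bar> * \<bar>g 0\<bar>" using x by (intro mult_right_mono) auto
  then show ?case using g1 by (simp add: abs_mult)
next
  case (Suc j)
  have "2 * \<bar>g (Suc j)\<bar> \<le> \<bar>x * g (Suc j)\<bar>"
    unfolding abs_mult using x by (intro mult_right_mono) auto
  moreover have "\<bar>x * g (Suc j) - g (Suc (Suc j)) - g j\<bar> \<le> \<delta>"
    using rec[of "Suc j"] Suc.prems by simp
  ultimately have 1: "\<bar>g (Suc (Suc j))\<bar> - \<bar>g (Suc j)\<bar> \<ge> \<bar>g (Suc j)\<bar> - \<bar>g j\<bar> - \<delta>"
    by linarith
  have "\<delta> * real (Suc j) \<le> \<delta> * d" using Suc.prems \<delta> by (intro mult_left_mono) auto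
  with 1 Suc \<delta> show ?case by (auto simp: algebra_simps)
qed

text \<open>A large \<open>\<bar>g 0\<bar>\<close> would persist along the sequence, as energy of
  consecutive pairs for \<open>\<bar>x\<bar> \<le> 2\<close> and as size of every term otherwise.
  Summed over the indices, this exceeds the budget 3 for the squares.\<close>

proposition approximate_recurrence_bound:
  fixes g :: "nat \<Rightarrow> real" and x \<delta> \<epsilon> :: real
  assumes rec: "\<And>j. 1 \<le> j \<Longrightarrow> j < d \<Longrightarrow> \<bar>x * g j - g (j+1) - g (j-1)\<bar> \<le> \<delta>"
    and g1: "g 1 = x * g 0"
    and sum: "(\<Sum>j\<le>d. (g j)\<^sup>2) \<le> 3"
    and \<epsilon>: "0 < \<epsilon>" and d: "24 < \<epsilon>\<^sup>2 * d" and \<delta>: "0 \<le> \<delta>" "8 * \<delta> * d \<le> \<epsilon>\<^sup>2" "\<delta> * d \<le> \<epsilon>"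
  shows "\<bar>g 0\<bar> < \<epsilon>"
proof (rule ccontr)
  assume "\<not> ?thesis"
  then have g0: "\<epsilon> \<le> \<bar>g 0\<bar>" by simp
  then have g0sq: "\<epsilon>\<^sup>2 \<le> (g 0)\<^sup>2" using \<epsilon> abs_le_square_iff[of \<epsilon> "g 0"] by simp
  have bound: "\<bar>g j\<bar> \<le> 2" if "j \<le> d" for j
  proof -
    have "(g j)\<^sup>2 \<le> (\<Sum>j\<le>d. (g j)\<^sup>2)" using that by (intro member_le_sum) auto
    then have "(g j)\<^sup>2 \<le> 2\<^sup>2" using sum by simp
    then show ?thesis by (metis abs_le_square_iff abs_numeral)
  qed
  show False
  proof (cases "\<bar>x\<bar> \<le> 2")
    case True
    have *: "\<epsilon>\<^sup>2 / 2 \<le> 2 * ((g j)\<^sup>2 + (g (j+1))\<^sup>2)" if "j < d" for j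
    proof -
      \<comment> \<open>At least half of the initial energy survives:
        \<open>8 * \<delta> * d \<le> \<epsilon>\<^sup>2\<close> limits the total drift to
        \<open>\<epsilon>\<^sup>2 / 2\<close>.\<close>
      have "\<delta> * j \<le> \<delta> * d" using that \<delta> by (intro mult_left_mono) auto
      then have "\<epsilon>\<^sup>2 / 2 \<le> (g 0)\<^sup>2 - 4 * \<delta> * j" using g0sq \<delta> by linarith
      also have "\<dots> \<le> (g j)\<^sup>2 + (g (j+1))\<^sup>2 - x * g j * g (j+1)"
        by (rule energy_drift[OF rec g1 bound that \<delta>(1)])
      also have "\<dots> \<le> 2 * ((g j)\<^sup>2 + (g (j+1))\<^sup>2)" by (rule sq_form_le[OF True])
      finally show ?thesis .
    qed
    \<comment> \<open>Each index lies in at most two consecutive pairs, whence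
      \<open>2 * 3 + 2 * 3 = 12\<close> on the right, against
      \<open>24 < \<epsilon>\<^sup>2 * d\<close>.\<close>
    have "d * (\<epsilon>\<^sup>2 / 2) \<le> (\<Sum>j<d. 2 * ((g j)\<^sup>2 + (g (j+1))\<^sup>2))"
      using sum_mono[of "{..<d}" "\<lambda>_. \<epsilon>\<^sup>2 / 2", OF *] by simp
    also have "\<dots> = 2 * (\<Sum>j<d. (g j)\<^sup>2) + 2 * (\<Sum>j<d. (g (Suc j))\<^sup>2)"
      by (simp add: sum.distrib sum_distrib_left algebra_simps)
    also have "(\<Sum>j<d. (g j)\<^sup>2) \<le> (\<Sum>j\<le>d. (g j)\<^sup>2)" by (intro sum_mono2) auto
    also have "(\<Sum>j<d. (g (Suc j))\<^sup>2) \<le> (\<Sum>j\<le>d. (g j)\<^sup>2)"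
      unfolding sum.atMost_shift by simp
    finally have "d * (\<epsilon>\<^sup>2 / 2) \<le> 12" using sum by linarith
    with d show False by (simp add: algebra_simps)
  next
    case False
    have ge: "\<epsilon>\<^sup>2 \<le> (g j)\<^sup>2" if "j \<le> d" for j
    proof (cases j)
      case (Suc i)
      have "\<bar>g 0\<bar> \<le> \<bar>g j\<bar>"
        using growth_outside[OF rec g1, where j = i] False \<delta> g0 that Suc by auto
      then show ?thesis using g0sq by (meson abs_le_square_iff order_trans)
    qed (use g0sq in simp)
    have "(\<Sum>j\<le>d. \<epsilon>\<^sup>2) \<le> (\<Sum>j\<le>d. (g j)\<^sup>2)" by (intro sum_mono ge) auto
    then have "real (d+1) * \<epsilon>\<^sup>2 \<le> 3" using sum by simp
    then have "\<epsilon>\<^sup>2 * d + \<epsilon>\<^sup>2 \<le> 3" by (simp add: algebra_simps)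
    then show False using d zero_le_power2[of \<epsilon>] by linarith
  qed
qed

subsection \<open>Eigenvectors at tree-like vertices\<close>

locale finite_graph =
  fixes V :: "'a set" and N :: "'a \<Rightarrow> 'a set"
  assumes finite_V: "finite V"
    and N_subset: "y \<in> N v \<Longrightarrow> y \<in> V"
    and N_sym: "y \<in> N v \<Longrightarrow> v \<in> N y"
    and N_irrefl: "v \<notin> N v"
begin

lemma finite_N [simp]: "finite (N v)"
  using finite_V N_subset finite_subset[of "N v" V] by blast

abbreviation adj :: "'a \<Rightarrow> 'a \<Rightarrow> bool" where "adj a b \<equiv> b \<in> N a"

text \<open>Paths are listed from their far end \<open>hd\<close> back to their starting vertex \<open>last\<close>.\<close>

definition path_from :: "'a \<Rightarrow> 'a list \<Rightarrow> bool" where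
  "path_from k xs \<longleftrightarrow> xs \<noteq> [] \<and> last xs = k \<and> distinct xs \<and> set xs \<subseteq> V \<and> successively adj xs"

definition paths :: "'a \<Rightarrow> nat \<Rightarrow> 'a list set" where
  "paths k j = {xs. path_from k xs \<and> length xs = Suc j}"

text \<open>The far end has index 0, and its edge to entry \<open>c\<close> closes a cycle of length
  \<open>c + 1\<close>; the later entries are a tail leading to the start. \<open>2 \<le> c\<close>
  excludes the edge to the predecessor, which belongs to the path itself.\<close>

definition lollipop :: "'a list \<Rightarrow> nat \<Rightarrow> bool" where
  "lollipop zs c \<longleftrightarrow> distinct zs \<and> set zs \<subseteq> V \<and> successively adj zs \<and> 2 \<le> c \<and> c < length zs \<and> zs ! c \<in> N (hd zs)"

lemma finite_paths [simp]: "finite (paths k j)"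
  by (rule finite_subset[OF _ finite_lists_length_eq[OF finite_V, of "Suc j"]])
    (auto simp: paths_def path_from_def)

lemma path_from_suffix:
  assumes "path_from k (as @ ys)" "ys \<noteq> []"
  shows "path_from k ys"
  using assms by (auto simp: path_from_def successively_append_iff)

lemma path_from_Cons:
  "xs \<noteq> [] \<Longrightarrow> path_from k (y # xs) \<longleftrightarrow> path_from k xs \<and> y \<in> N (hd xs) - set xs"
  by (cases xs) (auto simp: path_from_def N_subset dest: N_sym)

lemma paths_0: "k \<in> V \<Longrightarrow> paths k 0 = {[k]}"
  by (auto simp: paths_def path_from_def length_Suc_conv)

lemma paths_Suc:
  "bij_betw (\<lambda>(xs, y). y # xs) (SIGMA xs:paths k j. N (hd xs) - set xs) (paths k (Suc j))"
  unfolding bij_betw_def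
proof
  show "inj_on (\<lambda>(xs, y). y # xs) (SIGMA xs:paths k j. N (hd xs) - set xs)"
    by (auto simp: inj_on_def)
  show "(\<lambda>(xs, y). y # xs) ` (SIGMA xs:paths k j. N (hd xs) - set xs) = paths k (Suc j)"
  proof (intro equalityI subsetI)
    fix zs assume "zs \<in> paths k (Suc j)"
    then obtain y xs where zs: "zs = y # xs" "xs \<noteq> []" "length xs = Suc j" "path_from k (y # xs)"
      by (auto simp: paths_def length_Suc_conv)
    with path_from_Cons[of xs k y]
    have "(xs, y) \<in> (SIGMA xs:paths k j. N (hd xs) - set xs)"
      by (auto simp: paths_def)
    with zs(1) show "zs \<in> (\<lambda>(xs, y). y # xs) ` (SIGMA xs:paths k j. N (hd xs) - set xs)"
      by (auto intro!: rev_image_eqI)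
  next
    fix zs assume "zs \<in> (\<lambda>(xs, y). y # xs) ` (SIGMA xs:paths k j. N (hd xs) - set xs)"
    then obtain xs y where "zs = y # xs" "xs \<in> paths k j" "y \<in> N (hd xs) - set xs" by auto
    then show "zs \<in> paths k (Suc j)"
      using path_from_Cons[of xs k y] by (cases xs) (auto simp: paths_def)
  qed
qed

lemma card_paths_Suc: "card (paths k (Suc j)) = (\<Sum>xs\<in>paths k j. card (N (hd xs) - set xs))"
  using bij_betw_same_card[OF paths_Suc, of k j] by simp

text \<open>Irreflexivity excludes position 0, and a position from 2 on would close a lollipop, so
  only the predecessor remains.\<close>

lemma neighbours_on_path:
  assumes nl: "\<And>c. \<not> lollipop zs c" and zs: "path_from k zs" and y: "y \<in> N (hd zs)" "y \<in> set zs"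
  shows "\<exists>r. zs = hd zs # y # r"
proof -
  obtain c where c: "c < length zs" "zs ! c = y" using y(2) by (metis in_set_conv_nth)
  have "c \<noteq> 0" using c y(1) N_irrefl by (metis hd_conv_nth length_0_conv not_less_zero)
  moreover have "\<not> 2 \<le> c" using nl[of c] zs c y(1) by (auto simp: lollipop_def path_from_def)
  ultimately have "c = 1" by simp
  with c show ?thesis by (cases zs; cases "tl zs") auto
qed

text \<open>Moving the vertices of \<open>ws\<close> one by one to the front of \<open>zs\<close>
  keeps a path from \<open>k\<close> and the total length. By \<open>neighbours_on_path\<close> the
  walk could return only to the vertex just left, which distinctness forbids.\<close>

lemma no_return:
  assumes nl: "\<And>zs c. path_from k zs \<Longrightarrow> length zs \<le> L \<Longrightarrow> \<not> lollipop zs c"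
  shows "path_from k zs \<Longrightarrow> successively adj (hd zs # ws) \<Longrightarrow> distinct (hd zs # ws) \<Longrightarrow> ws \<noteq> [] \<Longrightarrow>
    hd ws \<notin> set zs \<Longrightarrow> length zs + length ws \<le> L \<Longrightarrow> last ws \<notin> set zs"
proof (induction ws arbitrary: zs)
  case (Cons w ws)
  show ?case
  proof (cases ws)
    case (Cons w' ws')
    have zs_ne: "zs \<noteq> []" using Cons.prems(1) by (simp add: path_from_def)
    have p: "path_from k (w # zs)" using Cons.prems zs_ne by (auto simp: path_from_Cons)
    have "w' \<notin> set (w # zs)"
    proof
      assume "w' \<in> set (w # zs)"
      moreover have "\<And>c. \<not> lollipop (w # zs) c" using nl[OF p] Cons.prems \<open>ws = w' # ws'\<close> by simp
      moreover have "w' \<in> N (hd (w # zs))" using Cons.prems \<open>ws = w' # ws'\<close> by simp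
      ultimately obtain r where "w # zs = w # w' # r" using neighbours_on_path[OF _ p, of w'] by auto
      then have "w' = hd zs" by (auto)
      then show False using Cons.prems \<open>ws = w' # ws'\<close> by auto
    qed
    then have "last ws \<notin> set (w # zs)"
      using Cons.prems \<open>ws = w' # ws'\<close> by (intro Cons.IH[OF p]) auto
    then show ?thesis using \<open>ws = w' # ws'\<close> by auto
  qed (use Cons.prems in auto)
qed auto

text \<open>Compare the predecessors of the common end. If the one in \<open>ys\<close> were off
  \<open>xs\<close>, then by \<open>no_return\<close> the rest of \<open>ys\<close> could not end on
  \<open>xs\<close>, yet both end in \<open>k\<close>; so it is the predecessor in \<open>xs\<close>
  as well. For paths with at most \<open>d + 1\<close> vertices this needs the length bound
  \<open>2 * d + 2\<close> used below.\<close>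

lemma path_unique:
  assumes nl: "\<And>zs c. path_from k zs \<Longrightarrow> length zs \<le> L \<Longrightarrow> \<not> lollipop zs c"
  shows "path_from k xs \<Longrightarrow> path_from k ys \<Longrightarrow> hd xs = hd ys \<Longrightarrow> length xs + length ys \<le> L \<Longrightarrow> xs = ys"
proof (induction xs arbitrary: ys)
  case (Cons v xs')
  then obtain ys' where ys: "ys = v # ys'" by (cases ys) (auto simp: path_from_def)
  show ?case
  proof (cases "xs' = [] \<or> ys' = []")
    case True
    then show ?thesis using Cons.prems ys last_in_set[of xs'] last_in_set[of ys']
      by (auto simp: path_from_def split: if_splits)
  next
    case False
    define y where "y = hd ys'"
    have y: "y \<in> N v" using Cons.prems False ys by (cases ys') (auto simp: path_from_def y_def)
    have "y \<in> set (v # xs')"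
    proof (rule ccontr)
      assume "y \<notin> set (v # xs')"
      then have "last ys' \<notin> set (v # xs')"
        using Cons.prems False ys
        by (intro no_return[OF nl, where zs = "v # xs'" and ws = ys'])
          (auto simp: path_from_def y_def)
      moreover have "last ys' = last (v # xs')" using Cons.prems False ys by (auto simp: path_from_def)
      ultimately show False by (metis last_in_set list.discI)
    qed
    moreover have "\<And>c. \<not> lollipop (v # xs') c" using nl Cons.prems by auto
    ultimately obtain r where "xs' = y # r" using neighbours_on_path[of "v # xs'" k y] y Cons.prems by auto
    moreover have "path_from k xs'" "path_from k ys'"
      using Cons.prems False ys path_from_suffix[of k "[v]"] by auto
    ultimately have "xs' = ys'" using Cons.IH[of ys'] Cons.prems ys False by (auto simp: y_def)
    then show ?thesis using ys by simp
  qed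
qed (simp add: path_from_def)

end

section \<open>Sphere sums of an eigenvector around a tree-like vertex\<close>

lemma geometric_ratio_le_3:
  fixes \<eta> :: real and d :: nat
  assumes "0 \<le> \<eta>" "\<eta> * d \<le> 1" "j \<le> d"
  shows "(1 + \<eta>) ^ j \<le> 3"
proof -
  have "(1 + \<eta>) ^ j \<le> (1 + \<eta>) ^ d" using assms by (intro power_increasing) auto
  also have "\<dots> \<le> exp \<eta> ^ d" using assms exp_ge_add_one_self[of \<eta>] by (intro power_mono) auto
  also have "\<dots> = exp (\<eta> * d)" using exp_of_nat_mult[of d \<eta>] by (simp add: mult.commute)
  also have "\<dots> \<le> exp 1" using assms by simp
  also have "\<dots> \<le> 3" by (rule exp_le)
  finally show ?thesis .
qed

text \<open>\<open>q\<^sup>2\<close> stands for the average degree, so \<open>\<Lambda> / q\<close>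
  is the normalised eigenvalue. \<open>1 \<le> \<eta> * q\<^sup>2\<close> lets the degree tolerance
  absorb the one neighbour that is the parent.\<close>

locale treelike_vertex = finite_graph +
  fixes k :: 'a and d :: nat and q \<eta> :: real and u :: "'a \<Rightarrow> real" and \<Lambda> :: real
  assumes k: "k \<in> V"
    and no_lollipop: "path_from k zs \<Longrightarrow> length zs \<le> 2 * d + 2 \<Longrightarrow> \<not> lollipop zs c"
    and degree: "path_from k zs \<Longrightarrow> length zs \<le> 2 * d + 2 \<Longrightarrow> \<bar>card (N (hd zs)) - q\<^sup>2\<bar> \<le> \<eta> * q\<^sup>2"
    and eigen: "v \<in> V \<Longrightarrow> (\<Sum>y\<in>N v. u y) = \<Lambda> * u v"
    and unit: "(\<Sum>v\<in>V. (u v)\<^sup>2) \<le> 1"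
    and q: "0 < q" and \<eta>: "0 < \<eta>" "\<eta> * d \<le> 1" "1 \<le> \<eta> * q\<^sup>2"
begin

text \<open>By \<open>path_unique\<close> distinct paths of at most \<open>d\<close> edges end in
  distinct vertices, so the spheres are disjoint and share the total mass of
  \<open>u\<close>.\<close>

lemma sum_layers_le: "(\<Sum>j\<le>d. \<Sum>xs\<in>paths k j. (u (hd xs))\<^sup>2) \<le> 1"
proof -
  have "(\<Sum>j\<le>d. \<Sum>xs\<in>paths k j. (u (hd xs))\<^sup>2) = (\<Sum>xs\<in>(\<Union>j\<le>d. paths k j). (u (hd xs))\<^sup>2)"
    by (rule sum.UNION_disjoint[symmetric]) (simp_all, auto simp: paths_def)
  also have "\<dots> = (\<Sum>v\<in>hd ` (\<Union>j\<le>d. paths k j). (u v)\<^sup>2)"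
  proof (rule sum.reindex[symmetric, unfolded o_def])
    show "inj_on hd (\<Union>j\<le>d. paths k j)"
      by (rule inj_onI, rule path_unique[OF no_lollipop])
        (auto simp: paths_def)
  qed
  also have "\<dots> \<le> (\<Sum>v\<in>V. (u v)\<^sup>2)"
    by (intro sum_mono2 finite_V) (auto simp: paths_def path_from_def)
  finally show ?thesis using unit by simp
qed

lemma layer_le: "j \<le> d \<Longrightarrow> (\<Sum>xs\<in>paths k j. (u (hd xs))\<^sup>2) \<le> 1"
  using member_le_sum[of j "{..d}" "\<lambda>j. \<Sum>xs\<in>paths k j. (u (hd xs))\<^sup>2"] sum_layers_le
  by (simp add: sum_nonneg)

lemma card_paths_le:
  assumes "j \<le> d"
  shows "card (paths k j) \<le> 3 * q ^ (2 * j)"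
proof -
  have "j \<le> d \<Longrightarrow> card (paths k j) \<le> ((1 + \<eta>) * q\<^sup>2) ^ j"
  proof (induction j)
    case 0
    then show ?case by (simp add: paths_0 k)
  next
    case (Suc j)
    have "real (card (paths k (Suc j))) = (\<Sum>xs\<in>paths k j. real (card (N (hd xs) - set xs)))"
      by (simp add: card_paths_Suc)
    also have "\<dots> \<le> (\<Sum>xs\<in>paths k j. (1 + \<eta>) * q\<^sup>2)"
    proof (rule sum_mono)
      fix xs assume xs: "xs \<in> paths k j"
      have "real (card (N (hd xs) - set xs)) \<le> card (N (hd xs))" by (simp add: card_mono)
      also have "\<dots> \<le> (1 + \<eta>) * q\<^sup>2"
        using degree[of xs] xs Suc.prems by (auto simp: paths_def algebra_simps abs_le_iff)
      finally show "real (card (N (hd xs) - set xs)) \<le> (1 + \<eta>) * q\<^sup>2" .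
    qed
    also have "\<dots> = (1 + \<eta>) * q\<^sup>2 * card (paths k j)" by (simp add: mult.commute)
    also have "\<dots> \<le> (1 + \<eta>) * q\<^sup>2 * ((1 + \<eta>) * q\<^sup>2) ^ j"
      using Suc \<eta> by (intro mult_left_mono) auto
    finally show ?case by simp
  qed
  then have "real (card (paths k j)) \<le> (1 + \<eta>) ^ j * q ^ (2 * j)"
    using assms by (simp add: power_mult_distrib power_mult)
  also have "\<dots> \<le> 3 * q ^ (2 * j)"
    using geometric_ratio_le_3[of \<eta> d j] \<eta> assms by (intro mult_right_mono) auto
  finally show ?thesis .
qed

definition S :: "nat \<Rightarrow> real" where "S j = (\<Sum>xs\<in>paths k j. u (hd xs))"

text \<open>Cauchy-Schwarz with the size of the sphere. The modulus stands inside the sum because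
  the error of the recurrence needs this stronger form.\<close>

lemma S_sq_le:
  assumes "j \<le> d"
  shows "(\<Sum>xs\<in>paths k j. \<bar>u (hd xs)\<bar>)\<^sup>2 \<le> 3 * q ^ (2 * j) * (\<Sum>xs\<in>paths k j. (u (hd xs))\<^sup>2)"
proof -
  have "(\<Sum>xs\<in>paths k j. 1 * \<bar>u (hd xs)\<bar>)\<^sup>2
      \<le> (\<Sum>xs\<in>paths k j. 1\<^sup>2) * (\<Sum>xs\<in>paths k j. \<bar>u (hd xs)\<bar>\<^sup>2)"
    by (rule Cauchy_Schwarz_ineq_sum)
  also have "\<dots> \<le> 3 * q ^ (2 * j) * (\<Sum>xs\<in>paths k j. \<bar>u (hd xs)\<bar>\<^sup>2)"
    using card_paths_le[OF assms] by (intro mult_right_mono) (auto intro: sum_nonneg)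
  finally show ?thesis by simp
qed

text \<open>Both sides run over all extensions of a path by one vertex. Since \<open>f\<close> sees
  the new end and the old path, the identity serves both for summing over children and for counting
  them.\<close>

lemma sum_neighbours_off_path:
  "(\<Sum>xs\<in>paths k j. \<Sum>y\<in>N (hd xs) - set xs. f y xs) = (\<Sum>zs\<in>paths k (Suc j). f (hd zs) (tl zs))"
proof -
  have "(\<Sum>xs\<in>paths k j. \<Sum>y\<in>N (hd xs) - set xs. f y xs)
      = (\<Sum>p\<in>(SIGMA xs:paths k j. N (hd xs) - set xs). case p of (xs, y) \<Rightarrow> f y xs)"
    by (rule sum.Sigma) simp_all
  also have "\<dots> = (\<Sum>p\<in>(SIGMA xs:paths k j. N (hd xs) - set xs).
      (\<lambda>zs. f (hd zs) (tl zs)) ((\<lambda>(xs, y). y # xs) p))"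
    by (rule sum.cong) auto
  also have "\<dots> = (\<Sum>zs\<in>paths k (Suc j). f (hd zs) (tl zs))"
    by (rule sum.reindex_bij_betw[OF paths_Suc])
  finally show ?thesis .
qed

text \<open>The eigenvalue equation is summed over the sphere of radius \<open>Suc i\<close>.
  Off-path neighbours make up the next sphere; the parents give each vertex of the sphere of radius
  \<open>i\<close> as often as it has children.\<close>

lemma S_recurrence:
  assumes "Suc i < d"
  shows "\<Lambda> * S (Suc i) = S (Suc (Suc i)) + (\<Sum>ys\<in>paths k i. card (N (hd ys) - set ys) * u (hd ys))"
proof -
  have in_V: "hd xs \<in> V" if "xs \<in> paths k j" for xs j
    using that by (auto simp: paths_def path_from_def)
  have "\<Lambda> * S (Suc i) = (\<Sum>xs\<in>paths k (Suc i). \<Sum>y\<in>N (hd xs). u y)"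
    unfolding S_def sum_distrib_left by (intro sum.cong) (auto simp: eigen in_V)
  also have "\<dots> = (\<Sum>xs\<in>paths k (Suc i). (\<Sum>y\<in>N (hd xs) - set xs. u y) + u (hd (tl xs)))"
  proof (rule sum.cong)
    fix xs assume xs: "xs \<in> paths k (Suc i)"
    then have p: "path_from k xs" and len: "length xs \<le> 2 * d + 2" using assms by (auto simp: paths_def)
    obtain a b r where abr: "xs = a # b # r" using xs by (auto simp: paths_def length_Suc_conv)
    have "b \<in> N (hd xs) \<inter> set xs" using p abr by (simp add: path_from_def)
    moreover have "y = b" if "y \<in> N (hd xs) \<inter> set xs" for y
      using neighbours_on_path[OF no_lollipop[OF p len] p, of y] that abr by auto
    ultimately have "N (hd xs) \<inter> set xs = {b}" by blast
    then show "(\<Sum>y\<in>N (hd xs). u y) = (\<Sum>y\<in>N (hd xs) - set xs. u y) + u (hd (tl xs))"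
      unfolding sum.Int_Diff[OF finite_N, of u "hd xs" "set xs"] using abr by simp
  qed simp
  also have "\<dots> = S (Suc (Suc i)) + (\<Sum>xs\<in>paths k (Suc i). u (hd (tl xs)))"
    unfolding sum.distrib sum_neighbours_off_path[where f = "\<lambda>y _. u y"] S_def by simp
  also have "(\<Sum>xs\<in>paths k (Suc i). u (hd (tl xs)))
      = (\<Sum>ys\<in>paths k i. card (N (hd ys) - set ys) * u (hd ys))"
    using sum_neighbours_off_path[where f = "\<lambda>_ ys. u (hd ys)"] by simp
  finally show ?thesis .
qed

text \<open>At most one neighbour of the end, its parent, lies on the path. Removing it costs at
  most \<open>1 \<le> \<eta> * q\<^sup>2\<close>, which doubles the tolerance.\<close>

lemma branching_deviation:
  assumes "ys \<in> paths k i" "i \<le> d"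
  shows "\<bar>card (N (hd ys) - set ys) - q\<^sup>2\<bar> \<le> 2 * \<eta> * q\<^sup>2"
proof -
  have p: "path_from k ys" and len: "length ys \<le> 2 * d + 2" using assms by (auto simp: paths_def)
  \<comment> \<open>For \<open>i = 0\<close> the entry \<open>ys ! 1\<close> is unspecified, but
    then the intersection is empty.\<close>
  have "N (hd ys) \<inter> set ys \<subseteq> {ys ! 1}"
  proof
    fix y assume "y \<in> N (hd ys) \<inter> set ys"
    then obtain r where "ys = hd ys # y # r" using neighbours_on_path[OF no_lollipop[OF p len] p] by auto
    then have "ys ! 1 = (hd ys # y # r) ! 1" by simp
    then show "y \<in> {ys ! 1}" by simp
  qed
  then have "card (N (hd ys) \<inter> set ys) \<le> 1" using card_mono[of "{ys ! 1}"] by simp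
  moreover have "card (N (hd ys)) = card (N (hd ys) - set ys) + card (N (hd ys) \<inter> set ys)"
    by (simp add: card_Diff_subset_Int card_mono)
  ultimately show ?thesis using degree[OF p len] \<eta>(3) by linarith
qed

text \<open>The scaling is by the square root of the expected sphere size; it turns the coefficient
  \<open>q\<^sup>2\<close> of the preceding sphere into 1.\<close>

definition g :: "nat \<Rightarrow> real" where "g j = S j / q ^ j"

text \<open>The defect is at most the branching deviation \<open>2 * \<eta> * q\<^sup>2\<close>
  times the absolute sum of \<open>u\<close> over the sphere of radius \<open>i\<close>. The latter
  is at most \<open>2 * q ^ i\<close>, with 2 replacing the square root of 3; division by
  \<open>q ^ (i+2)\<close> leaves \<open>4 * \<eta>\<close>.\<close>

lemma g_recurrence:
  assumes "1 \<le> j" "j < d"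
  shows "\<bar>\<Lambda> / q * g j - g (j+1) - g (j-1)\<bar> \<le> 4 * \<eta>"
proof -
  obtain i where j: "j = Suc i" using assms(1) by (cases j) auto
  have sq: "(\<Sum>ys\<in>paths k i. \<bar>u (hd ys)\<bar>)\<^sup>2 \<le> (2 * q ^ i)\<^sup>2"
  proof -
    have "(\<Sum>ys\<in>paths k i. \<bar>u (hd ys)\<bar>)\<^sup>2 \<le> 3 * q ^ (2 * i) * (\<Sum>xs\<in>paths k i. (u (hd xs))\<^sup>2)"
      using assms j by (intro S_sq_le) auto
    also have "\<dots> \<le> 3 * q ^ (2 * i) * 1" using assms j q by (intro mult_left_mono layer_le) auto
    also have "\<dots> \<le> (2 * q ^ i)\<^sup>2"
      using q by (simp add: power_mult_distrib power_mult[symmetric] mult.commute)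
    finally show ?thesis .
  qed
  have abs_le: "(\<Sum>ys\<in>paths k i. \<bar>u (hd ys)\<bar>) \<le> 2 * q ^ i"
    using power2_le_imp_le[OF sq] q by simp
  have "\<bar>\<Lambda> * S (Suc i) - S (Suc (Suc i)) - q\<^sup>2 * S i\<bar>
      = \<bar>\<Sum>ys\<in>paths k i. (card (N (hd ys) - set ys) - q\<^sup>2) * u (hd ys)\<bar>"
    using S_recurrence[of i] assms j
    by (simp add: S_def sum_distrib_left sum_subtractf[symmetric] left_diff_distrib)
  also have "\<dots> \<le> (\<Sum>ys\<in>paths k i. 2 * \<eta> * q\<^sup>2 * \<bar>u (hd ys)\<bar>)"
    using assms j branching_deviation
    by (intro order_trans[OF sum_abs] sum_mono) (auto simp: abs_mult intro!: mult_right_mono)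
  also have "\<dots> \<le> 2 * \<eta> * q\<^sup>2 * (2 * q ^ i)"
    unfolding sum_distrib_left[symmetric] using abs_le \<eta> by (intro mult_left_mono) auto
  finally have *: "\<bar>\<Lambda> * S (Suc i) - S (Suc (Suc i)) - q\<^sup>2 * S i\<bar> \<le> 4 * \<eta> * q ^ (i+2)"
    by (simp add: power2_eq_square algebra_simps)
  have "\<Lambda> / q * g j - g (j+1) - g (j-1) = (\<Lambda> * S (Suc i) - S (Suc (Suc i)) - q\<^sup>2 * S i) / q ^ (i+2)"
    using q j by (simp add: g_def field_simps power2_eq_square)
  then have "\<bar>\<Lambda> / q * g j - g (j+1) - g (j-1)\<bar> = \<bar>\<Lambda> * S (Suc i) - S (Suc (Suc i)) - q\<^sup>2 * S i\<bar> / q ^ (i+2)"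
    using q by simp
  also have "\<dots> \<le> 4 * \<eta>" using * q by (subst pos_divide_le_eq) auto
  finally show ?thesis .
qed

lemma g_sum_sq: "(\<Sum>j\<le>d. (g j)\<^sup>2) \<le> 3"
proof -
  have "(g j)\<^sup>2 \<le> 3 * (\<Sum>xs\<in>paths k j. (u (hd xs))\<^sup>2)" if "j \<le> d" for j
  proof -
    have "(S j)\<^sup>2 \<le> (\<Sum>xs\<in>paths k j. \<bar>u (hd xs)\<bar>)\<^sup>2"
      using power_mono[OF sum_abs[of "\<lambda>xs. u (hd xs)" "paths k j"], of 2] by (simp add: S_def)
    also have "\<dots> \<le> 3 * q ^ (2 * j) * (\<Sum>xs\<in>paths k j. (u (hd xs))\<^sup>2)" by (rule S_sq_le[OF that])
    finally show ?thesis
      using q by (simp add: g_def power_divide pos_divide_le_eq power_mult[symmetric] mult_ac)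
  qed
  then have "(\<Sum>j\<le>d. (g j)\<^sup>2) \<le> (\<Sum>j\<le>d. 3 * (\<Sum>xs\<in>paths k j. (u (hd xs))\<^sup>2))"
    by (intro sum_mono) auto
  also have "\<dots> \<le> 3" unfolding sum_distrib_left[symmetric] using sum_layers_le by simp
  finally show ?thesis .
qed

text \<open>This is \<open>approximate_recurrence_bound\<close> for \<open>x = \<Lambda> / q\<close>
  and \<open>\<delta> = 4 * \<eta>\<close>, which explains the constants 32 and 4.\<close>

proposition coordinate_small:
  fixes \<epsilon> :: real
  assumes "0 < \<epsilon>" "24 < \<epsilon>\<^sup>2 * d" "32 * \<eta> * d \<le> \<epsilon>\<^sup>2" "4 * \<eta> * d \<le> \<epsilon>"
  shows "\<bar>u k\<bar> < \<epsilon>"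
proof -
  have g0: "g 0 = u k" by (simp add: g_def S_def paths_0 k)
  have "\<Lambda> * u k = (\<Sum>y\<in>N k. u y)" by (simp add: eigen k)
  \<comment> \<open>Deleting \<open>k\<close> changes nothing and gives the form to which
    \<open>sum_neighbours_off_path\<close> applies at \<open>j = 0\<close>.\<close>
  also have "N k = N k - {k}" using N_irrefl by simp
  also have "(\<Sum>y\<in>N k - {k}. u y) = S 1"
    using sum_neighbours_off_path[where f = "\<lambda>y _. u y" and j = 0] by (simp add: paths_0 k S_def)
  finally have "g 1 = \<Lambda> / q * g 0" unfolding g0 by (simp add: g_def)
  then have "\<bar>g 0\<bar> < \<epsilon>"
    using assms \<eta> by (intro approximate_recurrence_bound[OF g_recurrence _ g_sum_sq]) auto
  then show ?thesis by (simp add: g0)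
qed

end

subsection \<open>Counting exceptional vertices\<close>

context finite_graph
begin

text \<open>Only the vertices after the start are confined to \<open>W\<close>: the start may itself
  be atypical.\<close>

primrec walk_ends :: "'a set \<Rightarrow> nat \<Rightarrow> 'a \<Rightarrow> 'a set" where
  "walk_ends W 0 v = {v}"
| "walk_ends W (Suc l) v = (\<Union>y\<in>N v \<inter> W. walk_ends W l y)"

definition reach :: "'a set \<Rightarrow> nat \<Rightarrow> 'a \<Rightarrow> 'a set" where
  "reach W L v = (\<Union>l<L. walk_ends W l v)"

lemma finite_walk_ends [simp]: "finite (walk_ends W l v)"
  by (induction l arbitrary: v) auto

lemma finite_reach [simp]: "finite (reach W L v)"
  by (simp add: reach_def)

lemma last_in_walk_ends:
  "xs \<noteq> [] \<Longrightarrow> successively adj xs \<Longrightarrow> set (tl xs) \<subseteq> W \<Longrightarrow> last xs \<in> walk_ends W (length xs - 1) (hd xs)"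
proof (induction xs)
  case (Cons x xs)
  then show ?case by (cases xs) (auto intro!: bexI[of _ "hd xs"])
qed simp

lemma last_in_reach:
  "xs \<noteq> [] \<Longrightarrow> successively adj xs \<Longrightarrow> set (tl xs) \<subseteq> W \<Longrightarrow> length xs \<le> L \<Longrightarrow> last xs \<in> reach W L (hd xs)"
  using last_in_walk_ends[of xs W] by (cases xs) (auto simp: reach_def intro!: bexI[of _ "length xs - 1"])

definition all_in :: "'a set \<Rightarrow> nat \<Rightarrow> 'a \<Rightarrow> bool" where
  "all_in W L k \<longleftrightarrow> (\<forall>xs. path_from k xs \<longrightarrow> length xs \<le> L \<longrightarrow> hd xs \<in> W)"

lemma all_in_suffix:
  assumes "all_in W L k" "path_from k zs" "length zs \<le> L"
  shows "set zs \<subseteq> W"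
proof
  fix z assume "z \<in> set zs"
  then obtain as bs where zs: "zs = as @ z # bs" by (meson split_list)
  then have "path_from k (z # bs)" using assms(2) path_from_suffix by blast
  with assms zs show "z \<in> W" by (auto simp: all_in_def dest!: spec[of _ "z # bs"])
qed

context
  fixes W :: "'a set" and D :: real
  assumes W: "\<And>w. w \<in> W \<Longrightarrow> card (N w) \<le> D" and D: "1 \<le> D"
begin

text \<open>Only the first step may leave from a vertex of large degree; all later steps leave from
  \<open>W\<close> and cost a factor \<open>D\<close> each.\<close>

lemma card_walk_ends_Suc:
  assumes "\<And>y. y \<in> W \<Longrightarrow> card (walk_ends W l y) \<le> D ^ l"
  shows "card (walk_ends W (Suc l) v) \<le> card (N v) * D ^ l"
proof -
  have "card (walk_ends W (Suc l) v) \<le> (\<Sum>y\<in>N v \<inter> W. card (walk_ends W l y))"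
    unfolding walk_ends.simps by (rule card_UN_le) simp
  then have "real (card (walk_ends W (Suc l) v)) \<le> (\<Sum>y\<in>N v \<inter> W. card (walk_ends W l y))"
    by linarith
  also have "\<dots> \<le> (\<Sum>y\<in>N v \<inter> W. D ^ l)" unfolding of_nat_sum using assms by (intro sum_mono) auto
  also have "\<dots> \<le> card (N v) * D ^ l"
    using D by (auto intro!: mult_right_mono card_mono)
  finally show ?thesis .
qed

lemma card_walk_ends: "v \<in> W \<Longrightarrow> card (walk_ends W l v) \<le> D ^ l"
proof (induction l arbitrary: v)
  case (Suc l)
  have "card (walk_ends W (Suc l) v) \<le> card (N v) * D ^ l" by (rule card_walk_ends_Suc) (rule Suc.IH)
  also have "\<dots> \<le> D * D ^ l" using W[OF Suc.prems] D by (intro mult_right_mono) auto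
  finally show ?case by simp
qed simp

lemma card_reach_le:
  fixes B :: real
  assumes "\<And>l. l < L \<Longrightarrow> card (walk_ends W l v) \<le> B"
  shows "card (reach W L v) \<le> real L * B"
proof -
  have "real (card (reach W L v)) \<le> (\<Sum>l<L. card (walk_ends W l v))"
    unfolding reach_def by (intro of_nat_mono card_UN_le) simp
  also have "\<dots> \<le> (\<Sum>l<L. B)" unfolding of_nat_sum using assms by (intro sum_mono) auto
  finally show ?thesis by simp
qed

lemma card_reach_in: "v \<in> W \<Longrightarrow> card (reach W L v) \<le> L * D ^ L"
proof (rule card_reach_le)
  fix l assume "v \<in> W" "l < L"
  then show "card (walk_ends W l v) \<le> D ^ L"
    using card_walk_ends[of v l] power_increasing[of l L D] D by simp
qed

text \<open>The degree of the start enters linearly. Hence the sum of the atypical degrees controls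
  the union of these sets, with no bound on a single degree.\<close>

lemma card_reach: "card (reach W L v) \<le> L * (D ^ L * (card (N v) + 1))"
proof (rule card_reach_le)
  fix l assume l: "l < L"
  have "card (walk_ends W l v) \<le> D ^ l * (card (N v) + 1)"
  proof (cases l)
    case (Suc m)
    have "card (walk_ends W l v) \<le> card (N v) * D ^ m"
      unfolding Suc by (rule card_walk_ends_Suc) (rule card_walk_ends)
    also have "\<dots> \<le> (card (N v) + 1) * D ^ l"
      using D Suc power_increasing[of m l D] by (intro mult_mono) auto
    finally show ?thesis by (simp add: mult.commute)
  qed simp
  also have "\<dots> \<le> D ^ L * (card (N v) + 1)"
    using l D by (intro mult_right_mono power_increasing) auto
  finally show "card (walk_ends W l v) \<le> D ^ L * (card (N v) + 1)" .
qed

text \<open>On a shortest path from \<open>k\<close> that ends outside \<open>W\<close>, only the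
  far end is outside. Read from there, the path is a walk in \<open>W\<close> that puts
  \<open>k\<close> into the reach of an atypical vertex.\<close>

lemma card_not_all_in:
  "card {k\<in>V. \<not> all_in W L k} \<le> L * D ^ L * (\<Sum>v\<in>V - W. real (card (N v) + 1))"
proof -
  have "{k\<in>V. \<not> all_in W L k} \<subseteq> (\<Union>v\<in>V - W. reach W L v)"
  proof
    fix k assume "k \<in> {k\<in>V. \<not> all_in W L k}"
    then have ex: "\<exists>xs. path_from k xs \<and> length xs \<le> L \<and> hd xs \<notin> W" by (auto simp: all_in_def)
    obtain xs where xs: "path_from k xs" "length xs \<le> L" "hd xs \<notin> W"
      and least: "\<And>ys. path_from k ys \<and> length ys \<le> L \<and> hd ys \<notin> W \<Longrightarrow> length xs \<le> length ys"
      using ex_has_least_nat[of "\<lambda>xs. path_from k xs \<and> length xs \<le> L \<and> hd xs \<notin> W" _ length] ex by blast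
    have "set (tl xs) \<subseteq> W"
    proof
      fix z assume "z \<in> set (tl xs)"
      then obtain as bs where "tl xs = as @ z # bs" by (meson split_list)
      moreover have "xs \<noteq> []" using xs(1) by (simp add: path_from_def)
      ultimately have zs: "xs = (hd xs # as) @ z # bs" by (metis append_Cons list.collapse)
      then have "path_from k (z # bs)" using path_from_suffix[of k "hd xs # as" "z # bs"] xs(1) by simp
      moreover have "length (z # bs) < length xs" by (subst zs) simp
      ultimately show "z \<in> W" using least[of "z # bs"] xs(2) by fastforce
    qed
    then have "last xs \<in> reach W L (hd xs)" using xs by (intro last_in_reach) (auto simp: path_from_def)
    moreover have "hd xs \<in> V" using xs(1) by (auto simp: path_from_def)
    ultimately show "k \<in> (\<Union>v\<in>V - W. reach W L v)" using xs by (auto simp: path_from_def)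
  qed
  then have "card {k\<in>V. \<not> all_in W L k} \<le> card (\<Union>v\<in>V - W. reach W L v)"
    using finite_V by (intro card_mono) auto
  also have "\<dots> \<le> (\<Sum>v\<in>V - W. card (reach W L v))" using finite_V by (intro card_UN_le) auto
  finally have "real (card {k\<in>V. \<not> all_in W L k}) \<le> (\<Sum>v\<in>V - W. real (card (reach W L v)))"
    unfolding of_nat_sum[symmetric] by linarith
  also have "\<dots> \<le> (\<Sum>v\<in>V - W. L * (D ^ L * (card (N v) + 1)))"
    by (intro sum_mono card_reach)
  finally show ?thesis by (simp only: sum_distrib_left mult.assoc)
qed

end

section \<open>Vertices close to a short cycle\<close>

definition lollipop_pairs :: "nat \<Rightarrow> (('a list \<times> nat) \<times> ('a list \<times> nat)) set" where
  "lollipop_pairs L = {((zs, c), (ys, b)). lollipop zs c \<and> lollipop ys b \<and>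
     length zs \<le> L \<and> length ys \<le> L \<and> set zs \<inter> set ys = {}}"

lemma finite_lollipop_pairs: "finite (lollipop_pairs L)"
proof (rule finite_subset)
  let ?A = "{xs. set xs \<subseteq> V \<and> length xs \<le> L} \<times> {..<L}"
  show "lollipop_pairs L \<subseteq> ?A \<times> ?A" by (auto simp: lollipop_pairs_def lollipop_def)
  show "finite (?A \<times> ?A)" using finite_lists_length_le[OF finite_V] by blast
qed

text \<open>Each \<open>k\<close> in \<open>T\<close> gets one lollipop \<open>Z k\<close> starting
  at \<open>k\<close>. It meets boundedly many others, since balls within \<open>W\<close> are
  bounded, and the disjoint pairs inject into \<open>lollipop_pairs\<close>. So the square of
  \<open>card T\<close> is at most a constant times \<open>card T\<close> plus the number of
  pairs.\<close>

lemma card_near_lollipop: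
  fixes D :: real and L :: nat
  assumes W: "\<And>w. w \<in> W \<Longrightarrow> card (N w) \<le> D" and D: "1 \<le> D"
  defines "T \<equiv> {k\<in>V. all_in W L k \<and> (\<exists>zs c. path_from k zs \<and> length zs \<le> L \<and> lollipop zs c)}"
  shows "card T \<le> real L * L * D ^ L + sqrt (card (lollipop_pairs L))"
proof -
  have finT: "finite T" using finite_V by (auto simp: T_def)
  have "\<forall>k\<in>T. \<exists>zs c. path_from k zs \<and> length zs \<le> L \<and> lollipop zs c" by (auto simp: T_def)
  then obtain Z C where Z: "\<And>k. k \<in> T \<Longrightarrow> path_from k (Z k) \<and> length (Z k) \<le> L \<and> lollipop (Z k) (C k)"
    by metis
  have ZW: "set (Z k) \<subseteq> W" if "k \<in> T" for k
    using all_in_suffix[of W L k "Z k"] Z that by (auto simp: T_def)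
  \<comment> \<open>The part of \<open>Z k\<close> between \<open>w\<close> and \<open>k\<close> is
    a walk in \<open>W\<close>, so all lollipops through \<open>w\<close> start within reach of
    \<open>w\<close>.\<close>
  have through: "{k\<in>T. w \<in> set (Z k)} \<subseteq> reach W L w" for w
  proof
    fix k assume k: "k \<in> {k\<in>T. w \<in> set (Z k)}"
    then obtain as bs where s: "Z k = as @ w # bs" by (auto dest: split_list)
    have "path_from k (w # bs)" using Z[of k] k s path_from_suffix[of k as "w # bs"] by auto
    moreover have "set bs \<subseteq> W" "length (w # bs) \<le> L" using ZW[of k] Z[of k] k s by auto
    ultimately have "last (w # bs) \<in> reach W L (hd (w # bs))"
      by (intro last_in_reach) (auto simp: path_from_def)
    then show "k \<in> reach W L w" using \<open>path_from k (w # bs)\<close> by (auto simp: path_from_def)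
  qed
  have close: "card {k'\<in>T. set (Z k) \<inter> set (Z k') \<noteq> {}} \<le> real L * L * D ^ L" if k: "k \<in> T" for k
  proof -
    have "{k'\<in>T. set (Z k) \<inter> set (Z k') \<noteq> {}} \<subseteq> (\<Union>w\<in>set (Z k). reach W L w)" using through by blast
    then have "card {k'\<in>T. set (Z k) \<inter> set (Z k') \<noteq> {}} \<le> card (\<Union>w\<in>set (Z k). reach W L w)"
      by (intro card_mono) auto
    also have "\<dots> \<le> (\<Sum>w\<in>set (Z k). card (reach W L w))" by (intro card_UN_le) auto
    finally have "real (card {k'\<in>T. set (Z k) \<inter> set (Z k') \<noteq> {}}) \<le> (\<Sum>w\<in>set (Z k). real (card (reach W L w)))"
      unfolding of_nat_sum[symmetric] by linarith
    also have "\<dots> \<le> (\<Sum>w\<in>set (Z k). L * D ^ L)"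
      using ZW[OF k] by (intro sum_mono card_reach_in[OF W D]) auto
    also have "\<dots> = card (set (Z k)) * (L * D ^ L)" by simp
    also have "\<dots> \<le> L * (L * D ^ L)"
      using Z[OF k] card_length[of "Z k"] D by (intro mult_right_mono) auto
    finally show ?thesis by (simp add: mult.assoc)
  qed
  define far where "far = (SIGMA k:T. {k'\<in>T. set (Z k) \<inter> set (Z k') = {}})"
  have "card far \<le> card (lollipop_pairs L)"
  proof (rule card_inj_on_le)
    let ?f = "\<lambda>(k, k'). ((Z k, C k), (Z k', C k'))"
    show "inj_on ?f far"
    proof (rule inj_onI, clarsimp simp: far_def)
      \<comment> \<open>A lollipop determines its start, which is its last entry.\<close>
      fix a b a' b' assume "a \<in> T" "b \<in> T" "a' \<in> T" "b' \<in> T" "Z a = Z a'" "Z b = Z b'"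
      then show "a = a' \<and> b = b'" using Z by (metis path_from_def)
    qed
    show "?f ` far \<subseteq> lollipop_pairs L" using Z by (auto simp: far_def lollipop_pairs_def)
  qed (rule finite_lollipop_pairs)
  moreover have "(card T)\<^sup>2 = (\<Sum>k\<in>T. card {k'\<in>T. set (Z k) \<inter> set (Z k') \<noteq> {}}) + card far"
  proof -
    have "(card T)\<^sup>2 = (\<Sum>k\<in>T. card T)" by (simp add: power2_eq_square)
    also have "\<dots> = (\<Sum>k\<in>T. card {k'\<in>T. set (Z k) \<inter> set (Z k') \<noteq> {}} + card {k'\<in>T. set (Z k) \<inter> set (Z k') = {}})"
      by (intro sum.cong refl, subst card_Un_disjoint[symmetric]) (use finT in \<open>auto intro!: arg_cong[of _ _ card]\<close>)
    also have "\<dots> = (\<Sum>k\<in>T. card {k'\<in>T. set (Z k) \<inter> set (Z k') \<noteq> {}}) + card far"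
      using finT by (simp add: sum.distrib far_def)
    finally show ?thesis .
  qed
  moreover have "(\<Sum>k\<in>T. real (card {k'\<in>T. set (Z k) \<inter> set (Z k') \<noteq> {}})) \<le> (\<Sum>k\<in>T. real L * L * D ^ L)"
    by (intro sum_mono close)
  ultimately have main: "(real (card T))\<^sup>2 \<le> card T * (real L * L * D ^ L) + card (lollipop_pairs L)"
    by (simp flip: of_nat_sum of_nat_power)
  define s where "s = sqrt (card (lollipop_pairs L))"
  have s: "s\<^sup>2 = card (lollipop_pairs L)" "s \<ge> 0" by (simp_all add: s_def)
  \<comment> \<open>With \<open>B\<close> the constant: a number above \<open>B + s\<close> has a
    square above \<open>B\<close> times itself plus \<open>s\<^sup>2\<close>, contrary to
    \<open>main\<close>.\<close>
  show ?thesis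
  proof (rule ccontr)
    assume "\<not> ?thesis"
    then have gt: "card T > real L * L * D ^ L + s" by (simp add: s_def)
    moreover have "0 \<le> real L * L * D ^ L" using D by simp
    ultimately have pos: "card T \<ge> s" "real (card T) > 0" using s by linarith+
    have "real (card T) * card T > card T * (real L * L * D ^ L + s)"
      using gt pos by (intro mult_strict_left_mono) auto
    moreover have "card T * s \<ge> s * s" using pos s by (intro mult_right_mono) auto
    ultimately show False using main s by (simp add: power2_eq_square algebra_simps)
  qed
qed

text \<open>\<open>q\<^sup>2\<close> is the average degree.\<close>

definition typical :: "real \<Rightarrow> real \<Rightarrow> 'a set" where
  "typical q \<eta> = {v\<in>V. \<bar>real (card (N v)) - q\<^sup>2\<bar> \<le> \<eta> * q\<^sup>2}"

text \<open>\<open>Bad\<close> depends on the graph alone and serves all eigenpairs at once. It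
  collects the vertices with an atypical degree nearby and those with a lollipop in otherwise
  typical surroundings. Typical degrees are at most \<open>2 * q\<^sup>2\<close> because
  \<open>\<eta> \<le> 1\<close>.\<close>

proposition card_large_coordinates:
  fixes d :: nat and q \<eta> \<epsilon> :: real
  assumes q: "0 < q" and \<eta>: "0 < \<eta>" "\<eta> \<le> 1" "\<eta> * d \<le> 1" "1 \<le> \<eta> * q\<^sup>2"
    and \<epsilon>: "0 < \<epsilon>" "24 < \<epsilon>\<^sup>2 * d" "32 * \<eta> * d \<le> \<epsilon>\<^sup>2" "4 * \<eta> * d \<le> \<epsilon>"
  defines "L \<equiv> 2 * d + 2"
  obtains Bad where "Bad \<subseteq> V"
    and "card Bad \<le> L * (2 * q\<^sup>2) ^ L * (\<Sum>v\<in>V - typical q \<eta>. real (card (N v) + 1))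
      + real L * L * (2 * q\<^sup>2) ^ L + sqrt (card (lollipop_pairs L))"
    and "\<And>k (u :: 'a \<Rightarrow> real) \<Lambda>. k \<in> V - Bad \<Longrightarrow> \<forall>v\<in>V. (\<Sum>y\<in>N v. u y) = \<Lambda> * u v \<Longrightarrow> (\<Sum>v\<in>V. (u v)\<^sup>2) \<le> 1 \<Longrightarrow> \<bar>u k\<bar> < \<epsilon>"
proof
  define W where "W = typical q \<eta>"
  have \<eta>q: "\<eta> * q\<^sup>2 \<le> q\<^sup>2" using mult_right_mono[of \<eta> 1 "q\<^sup>2"] \<eta> by simp
  have W: "card (N w) \<le> 2 * q\<^sup>2" if "w \<in> W" for w
    using that \<eta>q by (simp add: W_def typical_def abs_le_iff)
  have D: "1 \<le> 2 * q\<^sup>2" using \<eta>q \<eta> by linarith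
  define B1 where "B1 = {k\<in>V. \<not> all_in W L k}"
  define T where "T = {k\<in>V. all_in W L k \<and> (\<exists>zs c. path_from k zs \<and> length zs \<le> L \<and> lollipop zs c)}"
  show "B1 \<union> T \<subseteq> V" by (auto simp: B1_def T_def)
  have "card (B1 \<union> T) \<le> card B1 + card T" by (rule card_Un_le)
  then show "card (B1 \<union> T) \<le> L * (2 * q\<^sup>2) ^ L * (\<Sum>v\<in>V - typical q \<eta>. real (card (N v) + 1))
      + real L * L * (2 * q\<^sup>2) ^ L + sqrt (card (lollipop_pairs L))"
    using card_not_all_in[where W = W and L = L, OF W D] card_near_lollipop[where W = W and L = L, OF W D]
    unfolding B1_def T_def W_def by linarith
  fix k \<Lambda> and u :: "'a \<Rightarrow> real"
  assume k: "k \<in> V - (B1 \<union> T)" and eigen: "\<forall>v\<in>V. (\<Sum>y\<in>N v. u y) = \<Lambda> * u v"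
    and unit: "(\<Sum>v\<in>V. (u v)\<^sup>2) \<le> 1"
  have kW: "all_in W L k" using k by (auto simp: B1_def)
  interpret treelike_vertex V N k d q \<eta> u \<Lambda>
  proof
    show "\<not> lollipop zs c" if "path_from k zs" "length zs \<le> 2 * d + 2" for zs c
      using k that kW by (auto simp: T_def L_def)
    show "\<bar>card (N (hd zs)) - q\<^sup>2\<bar> \<le> \<eta> * q\<^sup>2" if "path_from k zs" "length zs \<le> 2 * d + 2" for zs
      using kW that by (auto simp: all_in_def L_def W_def typical_def)
  qed (use k eigen unit q \<eta> in auto)
  show "\<bar>u k\<bar> < \<epsilon>" using \<epsilon> by (rule coordinate_small)
qed

end

subsection \<open>Orthonormal eigenbases of real symmetric matrices\<close>

text \<open>The characteristic polynomial has a complex root \<open>a\<close>. Symmetry makes the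
  value \<open>a * r\<close> of the Hermitian form at an eigenvector equal to its conjugate, and
  \<open>r \<noteq> 0\<close> then forces \<open>a\<close> to be real.\<close>

lemma symmetric_real_eigenvalue:
  fixes A :: "real mat"
  assumes A: "A \<in> carrier_mat n n" and sym: "transpose_mat A = A" and n: "0 < n"
  shows "\<exists>e. eigenvalue A e"
proof -
  let ?C = "map_mat complex_of_real A"
  have C: "?C \<in> carrier_mat n n" using A by simp
  obtain as where as: "char_poly ?C = (\<Prod>a\<leftarrow>as. [:- a, 1:])" "length as = n"
    using char_poly_factorized[OF C] by blast
  then obtain a as' where "as = a # as'" using n by (cases as) auto
  then have root: "poly (char_poly ?C) a = 0" using as by simp
  then obtain v where "eigenvector ?C v a"
    unfolding eigenvalue_root_char_poly[OF C, symmetric] eigenvalue_def by blast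
  then have v: "v \<in> carrier_vec n" "v \<noteq> 0\<^sub>v n" and ev: "?C *\<^sub>v v = a \<cdot>\<^sub>v v"
    using C by (auto simp: eigenvector_def)
  define r where "r = (\<Sum>i<n. (cmod (v $ i))\<^sup>2)"
  have "r \<noteq> 0"
  proof
    assume "r = 0"
    then have "\<forall>i<n. v $ i = 0" unfolding r_def by (subst (asm) sum_nonneg_eq_0_iff) auto
    then have "v = 0\<^sub>v n" using v by (intro eq_vecI) auto
    with v show False by simp
  qed
  have s: "(\<Sum>i<n. \<Sum>j<n. of_real (A $$ (i, j)) * v $ j * cnj (v $ i)) = a * of_real r"
  proof -
    have "(\<Sum>j<n. of_real (A $$ (i, j)) * v $ j * cnj (v $ i)) = a * of_real ((cmod (v $ i))\<^sup>2)" if "i < n" for i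
    proof -
      have "(\<Sum>j<n. of_real (A $$ (i, j)) * v $ j) = (?C *\<^sub>v v) $ i"
        using A v that by (auto simp: scalar_prod_def lessThan_atLeast0 intro!: sum.cong)
      also have "\<dots> = a * v $ i" using ev v that by simp
      finally show ?thesis
        unfolding sum_distrib_right[symmetric] complex_norm_square by (simp add: mult.assoc)
    qed
    then show ?thesis by (simp add: r_def sum_distrib_left)
  qed
  have "cnj (\<Sum>i<n. \<Sum>j<n. of_real (A $$ (i, j)) * v $ j * cnj (v $ i))
      = (\<Sum>i<n. \<Sum>j<n. of_real (A $$ (i, j)) * cnj (v $ j) * v $ i)" by simp
  also have "\<dots> = (\<Sum>j<n. \<Sum>i<n. of_real (A $$ (i, j)) * cnj (v $ j) * v $ i)" by (rule sum.swap)
  also have "\<dots> = (\<Sum>i<n. \<Sum>j<n. of_real (A $$ (i, j)) * v $ j * cnj (v $ i))"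
  proof (intro sum.cong refl)
    fix i j assume "i \<in> {..<n}" "j \<in> {..<n}"
    then have "A $$ (j, i) = A $$ (i, j)" using A sym index_transpose_mat(1)[of i A j] by simp
    then show "of_real (A $$ (j, i)) * cnj (v $ i) * v $ j = of_real (A $$ (i, j)) * v $ j * cnj (v $ i)" by simp
  qed
  finally have "cnj (a * of_real r) = a * of_real r" unfolding s .
  then have "cnj a = a" using \<open>r \<noteq> 0\<close> by simp
  then have "a = of_real (Re a)" by (metis complex_cnj_cancel_iff complex_is_Real_iff Reals_cnj_iff of_real_Re)
  then have "of_real (poly (char_poly A) (Re a)) = (0::complex)"
    using root of_real_hom.char_poly_hom[OF A, where ?'a = complex] by (metis of_real_hom.poly_map_poly)
  then have "poly (char_poly A) (Re a) = 0" by simp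
  then show ?thesis using eigenvalue_root_char_poly[OF A] by blast
qed

text \<open>Gram-Schmidt applied to a basis that begins with \<open>v\<close> leaves
  \<open>v\<close> unchanged. Normalising the result gives \<open>W\<close>, with \<open>c\<close>
  the reciprocal length of \<open>v\<close>.\<close>

lemma orthogonal_completion:
  fixes v :: "real vec"
  assumes v: "v \<in> carrier_vec n" "v \<noteq> 0\<^sub>v n"
  obtains W c where "W \<in> carrier_mat n n" "transpose_mat W * W = 1\<^sub>m n" "col W 0 = c \<cdot>\<^sub>v v"
proof -
  have n: "n \<noteq> 0" using v by (metis carrier_vecD eq_vecI index_zero_vec(2) not_less_zero)
  interpret cof_vec_space n "TYPE(real)" .
  define b where "b = basis_completion v"
  define ws where "ws = gram_schmidt n b"
  note bc = basis_completion[OF v, folded b_def]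
  note gs = gram_schmidt_result[OF bc(2,4,5) refl, folded ws_def]
  have len: "length ws = n" using gs bc by simp
  obtain vs where "b = v # vs" using bc n by (cases b) auto
  then have "hd ws = v" unfolding ws_def using v by simp
  then have ws0: "ws ! 0 = v" using len n by (metis hd_conv_nth length_0_conv)
  have wsc: "ws ! i \<in> carrier_vec n" if "i < n" for i using gs that len nth_mem by blast
  have orth: "ws ! i \<bullet> ws ! j = 0 \<longleftrightarrow> i \<noteq> j" if "i < n" "j < n" for i j
  proof -
    \<comment> \<open>Gram-Schmidt orthogonality is stated with a conjugate, which is trivial on
      real vectors.\<close>
    have "conjugate (ws ! j) = ws ! j" by (intro eq_vecI) auto
    then show ?thesis using corthogonalD[OF gs(2), of i j] that len by simp
  qed
  define c where "c i = 1 / sqrt (ws ! i \<bullet> ws ! i)" for i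
  define W where "W = mat_of_cols n (map (\<lambda>i. c i \<cdot>\<^sub>v ws ! i) [0..<n])"
  have W: "W \<in> carrier_mat n n" by (simp add: W_def mat_of_cols_def)
  have colW: "col W i = c i \<cdot>\<^sub>v ws ! i" if "i < n" for i
    unfolding W_def using that wsc by (subst col_mat_of_cols) auto
  have "transpose_mat W * W = 1\<^sub>m n"
  proof (rule eq_matI)
    fix i j assume "i < dim_row (1\<^sub>m n :: real mat)" "j < dim_col (1\<^sub>m n :: real mat)"
    then have ij: "i < n" "j < n" by auto
    have "(transpose_mat W * W) $$ (i, j) = c i * c j * (ws ! i \<bullet> ws ! j)"
    proof -
      have "(transpose_mat W * W) $$ (i, j) = col W i \<bullet> col W j" using ij W by simp
      also have "\<dots> = (c i \<cdot>\<^sub>v ws ! i) \<bullet> (c j \<cdot>\<^sub>v ws ! j)" using colW ij by simp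
      also have "\<dots> = c i * c j * (ws ! i \<bullet> ws ! j)"
        using wsc[OF ij(1)] wsc[OF ij(2)] by simp
      finally show ?thesis .
    qed
    also have "\<dots> = (if i = j then 1 else 0)"
    proof (cases "i = j")
      case True
      have "ws ! i \<bullet> ws ! i > 0"
        using orth[OF ij(1) ij(1)] sum_nonneg[of "{0..<n}" "\<lambda>k. ws ! i $ k * ws ! i $ k"] wsc[OF ij(1)]
        by (auto simp: scalar_prod_def less_le)
      then show ?thesis using True by (simp add: c_def)
    qed (use orth ij in simp)
    finally show "(transpose_mat W * W) $$ (i, j) = 1\<^sub>m n $$ (i, j)" using ij by simp
  qed (use W in auto)
  moreover have "col W 0 = c 0 \<cdot>\<^sub>v v" using colW[of 0] n ws0 by simp
  ultimately show ?thesis using that[OF W] by blast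
qed


text \<open>Deflation: an orthogonal \<open>W\<close> with an eigenvector as first column clears the
  first column of the conjugated matrix, symmetry clears its first row, and the induction hypothesis
  diagonalises the remaining block \<open>B\<close>.\<close>

theorem real_spectral_theorem:
  fixes A :: "real mat"
  assumes "A \<in> carrier_mat n n" "transpose_mat A = A"
  shows "\<exists>P \<in> carrier_mat n n. transpose_mat P * P = 1\<^sub>m n \<and> diagonal_mat (transpose_mat P * A * P)"
  using assms
proof (induction n arbitrary: A)
  case 0
  then show ?case by (intro bexI[of _ "1\<^sub>m 0"]) (auto simp: diagonal_mat_def)
next
  case (Suc n A)
  note A = Suc.prems(1) and sym = Suc.prems(2)
  obtain e where "eigenvalue A e" using symmetric_real_eigenvalue[OF A sym] by auto
  then obtain v where v: "v \<in> carrier_vec (Suc n)" "v \<noteq> 0\<^sub>v (Suc n)" and ev: "A *\<^sub>v v = e \<cdot>\<^sub>v v"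
    using A by (auto simp: eigenvalue_def eigenvector_def)
  obtain W c where W: "W \<in> carrier_mat (Suc n) (Suc n)" "transpose_mat W * W = 1\<^sub>m (Suc n)"
    and col0: "col W 0 = c \<cdot>\<^sub>v v" using orthogonal_completion[OF v] .
  define A' where "A' = transpose_mat W * (A * W)"
  have A': "A' \<in> carrier_mat (Suc n) (Suc n)" using A W by (simp add: A'_def)
  have symA': "transpose_mat A' = A'"
  proof -
    have "transpose_mat A' = transpose_mat (A * W) * transpose_mat (transpose_mat W)"
      unfolding A'_def by (rule transpose_mult) (use A W in auto)
    also have "transpose_mat (A * W) = transpose_mat W * A"
      using transpose_mult[OF A W(1)] sym by simp
    finally show ?thesis using A W by (simp add: A'_def)
  qed
  have A'0: "A' $$ (i, 0) = (if i = 0 then e else 0)" if "i < Suc n" for i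
  proof -
    have "A' $$ (i, 0) = col W i \<bullet> (A *\<^sub>v col W 0)"
      using that A W by (simp add: A'_def mult_mat_vec_def)
    also have "A *\<^sub>v col W 0 = e \<cdot>\<^sub>v col W 0"
      unfolding col0 using A v ev by (simp add: mult_mat_vec smult_smult_assoc mult.commute)
    also have "col W i \<bullet> (e \<cdot>\<^sub>v col W 0) = e * (col W i \<bullet> col W 0)"
      using W by (simp add: scalar_prod_smult_distrib[where n = "Suc n"])
    also have "col W i \<bullet> col W 0 = (transpose_mat W * W) $$ (i, 0)" using that W(1) by simp
    also have "\<dots> = (if i = 0 then 1 else 0)" using that unfolding W(2) by simp
    finally show ?thesis by simp
  qed
  define B where "B = mat n n (\<lambda>(i, j). A' $$ (Suc i, Suc j))"
  have B: "B \<in> carrier_mat n n" by (simp add: B_def)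
  have A'swap: "A' $$ (i, j) = A' $$ (j, i)" if "i < Suc n" "j < Suc n" for i j
    using symA' A' that index_transpose_mat(1)[of j A' i] by simp
  have "transpose_mat B = B" by (rule eq_matI) (auto simp: B_def A'swap)
  with Suc.IH[OF B] obtain Q where Q: "Q \<in> carrier_mat n n" "transpose_mat Q * Q = 1\<^sub>m n"
    and diagQ: "diagonal_mat (transpose_mat Q * B * Q)" by blast
  define E where "E = mat 1 1 (\<lambda>_. e)"
  have E: "E \<in> carrier_mat 1 1" by (simp add: E_def)
  have A'block: "A' = four_block_mat E (0\<^sub>m 1 n) (0\<^sub>m n 1) B"
  proof (rule eq_matI)
    fix i j assume "i < dim_row (four_block_mat E (0\<^sub>m 1 n) (0\<^sub>m n 1) B)" "j < dim_col (four_block_mat E (0\<^sub>m 1 n) (0\<^sub>m n 1) B)"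
    then have "i < Suc n" "j < Suc n" using E B by auto
    then show "A' $$ (i, j) = four_block_mat E (0\<^sub>m 1 n) (0\<^sub>m n 1) B $$ (i, j)"
      using A'0 A'swap[of 0 j] E B by (cases i; cases j) (auto simp: E_def B_def)
  qed (use A' E B in auto)
  define R where "R = four_block_mat (1\<^sub>m 1) (0\<^sub>m 1 n) (0\<^sub>m n 1) Q"
  have R: "R \<in> carrier_mat (Suc n) (Suc n)" 
    using four_block_carrier_mat[OF one_carrier_mat[of 1] Q(1)] by (simp add: R_def)
  have Rt: "transpose_mat R = four_block_mat (1\<^sub>m 1) (0\<^sub>m 1 n) (0\<^sub>m n 1) (transpose_mat Q)"
    unfolding R_def using Q by (subst transpose_four_block_mat[where ?nr1.0 = 1 and ?nc1.0 = 1 and ?nr2.0 = n and ?nc2.0 = n]) auto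
  have RR: "transpose_mat R * R = 1\<^sub>m (Suc n)"
    unfolding Rt unfolding R_def
    using Q by (subst mult_four_block_mat[where ?nr1.0 = 1 and ?n1.0 = 1 and ?n2.0 = n and ?nr2.0 = n and ?nc1.0 = 1 and ?nc2.0 = n]) auto
  have RAR: "transpose_mat R * A' * R = four_block_mat E (0\<^sub>m 1 n) (0\<^sub>m n 1) (transpose_mat Q * B * Q)"
  proof -
    have "transpose_mat R * A' = four_block_mat E (0\<^sub>m 1 n) (0\<^sub>m n 1) (transpose_mat Q * B)"
      unfolding Rt A'block
      using Q B E by (subst mult_four_block_mat[where ?nr1.0 = 1 and ?n1.0 = 1 and ?n2.0 = n and ?nr2.0 = n and ?nc1.0 = 1 and ?nc2.0 = n]) auto
    then show ?thesis unfolding R_def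
      using Q B E by (simp, subst mult_four_block_mat[where ?nr1.0 = 1 and ?n1.0 = 1 and ?n2.0 = n and ?nr2.0 = n and ?nc1.0 = 1 and ?nc2.0 = n]) auto
  qed
  let ?P = "W * R"
  have P: "?P \<in> carrier_mat (Suc n) (Suc n)" using W R by simp
  have Pt: "transpose_mat ?P = transpose_mat R * transpose_mat W" by (rule transpose_mult[OF W(1) R])
  have Wt: "transpose_mat W \<in> carrier_mat (Suc n) (Suc n)" and Rt': "transpose_mat R \<in> carrier_mat (Suc n) (Suc n)"
    using W R by auto
  have "transpose_mat ?P * ?P = transpose_mat R * ((transpose_mat W * W) * R)"
    unfolding Pt using assoc_mult_mat[OF Rt' Wt P] assoc_mult_mat[OF Wt W(1) R] by simp
  then have 1: "transpose_mat ?P * ?P = 1\<^sub>m (Suc n)" using W(2) R RR by simp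
  have "transpose_mat ?P * A * ?P = transpose_mat R * A' * R"
  proof -
    have "transpose_mat ?P * A * ?P = transpose_mat R * transpose_mat W * (A * (W * R))"
      unfolding Pt by (rule assoc_mult_mat) (use A W R in auto)
    also have "A * (W * R) = A * W * R" by (rule assoc_mult_mat[symmetric]) (use A W R in auto)
    also have "transpose_mat R * transpose_mat W * (A * W * R) = transpose_mat R * (transpose_mat W * (A * W * R))"
      by (rule assoc_mult_mat) (use A W R in auto)
    also have "transpose_mat W * (A * W * R) = A' * R"
      unfolding A'_def by (rule assoc_mult_mat[symmetric]) (use A W R in auto)
    also have "transpose_mat R * (A' * R) = transpose_mat R * A' * R"
      by (rule assoc_mult_mat[symmetric]) (use A' R in auto)
    finally show ?thesis .
  qed
  then have 2: "diagonal_mat (transpose_mat ?P * A * ?P)"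
    unfolding RAR using diagQ E Q B by (auto simp: diagonal_mat_def)
  from 1 2 P show ?case by blast
qed


lemma col_scalar_prod_orthogonal:
  fixes P :: "real mat"
  assumes "P \<in> carrier_mat n n" "transpose_mat P * P = 1\<^sub>m n" "i < n" "j < n"
  shows "col P i \<bullet> col P j = (if i = j then 1 else 0)"
proof -
  have "col P i \<bullet> col P j = (transpose_mat P * P) $$ (i, j)" using assms(1,3,4) by simp
  then show ?thesis using assms by simp
qed

text \<open>The bijection \<open>p\<close> allows the columns to be listed later in the order of
  their eigenvalues.\<close>

lemma orthonormal_basis_cols:
  fixes P :: "real mat"
  assumes P: "P \<in> carrier_mat n n" "transpose_mat P * P = 1\<^sub>m n"
    and p: "bij_betw p {1..n} {..<n}"
  shows "orthonormal_basis n (\<lambda>i. col P (p i))"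
proof -
  interpret vec_space "TYPE(real)" n .
  note orth = col_scalar_prod_orthogonal[OF P]
  have dist: "inj_on (col P) {..<n}"
  proof (rule inj_onI)
    fix i j assume "i \<in> {..<n}" "j \<in> {..<n}" "col P i = col P j"
    then show "i = j" using orth[of i j] orth[of i i] by (auto split: if_splits)
  qed
  have set: "(\<lambda>i. col P (p i)) ` {1..n} = set (cols P)"
    using P bij_betw_imp_surj_on[OF p] by (auto simp: cols_def image_image[symmetric])
  have "det P \<noteq> 0"
  proof
    assume "det P = 0"
    then have "det (transpose_mat P * P) = 0" using P(1) by (subst det_mult[of _ n]) auto
    then show False using P by simp
  qed
  then have li: "lin_indpt (set (cols P))" using lin_dep_cols_imp_det_0[OF P(1)] by blast
  have "card (set (cols P)) = n"
    using P dist card_image[of "col P" "{..<n}"] by (simp add: cols_def lessThan_atLeast0)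
  then have "basis (set (cols P))"
    using li P cols_dim[of P] by (intro dim_li_is_basis) (auto simp: dim_is_n)
  then show ?thesis
    unfolding orthonormal_basis_def set using orth bij_betwE[OF p] bij_betw_imp_inj_on[OF p]
    by (auto simp: inj_on_eq_iff)
qed

lemma proots_linear_factors: "proots (\<Prod>a\<leftarrow>as. [:- a, 1:]) = mset (as :: real list)"
proof (induction as)
  case (Cons a as)
  have "(\<Prod>a\<leftarrow>as. [:- a, 1:]) \<noteq> 0" by (auto simp: prod_list_zero_iff)
  with Cons show ?case by (simp add: proots_mult del: mult_pCons_left)
qed simp

text \<open>\<open>A\<close> is similar to the diagonal matrix \<open>D\<close>, so the roots of its
  characteristic polynomial are the diagonal entries with multiplicity. The permutation that sorts
  them also orders the columns of \<open>P\<close>.\<close>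

theorem ordered_eigenbasis_exists:
  fixes A :: "real mat"
  assumes A: "A \<in> carrier_mat n n" and sym: "transpose_mat A = A"
  shows "\<exists>u. ordered_eigenbasis n A u"
proof -
  obtain P where P: "P \<in> carrier_mat n n" "transpose_mat P * P = 1\<^sub>m n"
    and diag: "diagonal_mat (transpose_mat P * A * P)" using real_spectral_theorem[OF A sym] by blast
  define D where "D = transpose_mat P * A * P"
  have D: "D \<in> carrier_mat n n" using P A by (simp add: D_def)
  have Pt: "transpose_mat P \<in> carrier_mat n n" using P by simp
  have PPt: "P * transpose_mat P = 1\<^sub>m n" using mat_mult_left_right_inverse[OF Pt P(1) P(2)] .
  have PD: "P * D = A * P"
  proof -
    have "P * D = P * (transpose_mat P * (A * P))" using A P by (simp add: D_def)
    also have "\<dots> = P * transpose_mat P * (A * P)"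
      by (rule assoc_mult_mat[symmetric]) (use A P in auto)
    also have "\<dots> = A * P" using A P unfolding PPt by simp
    finally show ?thesis .
  qed
  have "A = P * D * transpose_mat P"
    unfolding PD using assoc_mult_mat[OF A P(1) Pt] PPt A by simp
  then have "similar_mat A D"
    unfolding similar_mat_def using similar_mat_witI[OF PPt P(2)] A D P Pt by blast
  moreover have "upper_triangular D" using diag D by (auto simp: D_def diagonal_mat_def)
  ultimately have cp: "char_poly A = (\<Prod>a\<leftarrow>diag_mat D. [:- a, 1:])"
    using char_poly_similar char_poly_upper_triangular[OF D] by metis
  have "proots (char_poly A) = mset (diag_mat D)"
    unfolding cp by (rule proots_linear_factors)
  then have eig: "eig i A = sort (diag_mat D) ! (i - 1)" for i by (simp add: eig_def)
  have lenD: "length (diag_mat D) = n" using D by (simp add: diag_mat_def)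
  obtain p where p: "p permutes {..<n}" "permute_list p (diag_mat D) = sort (diag_mat D)"
    using mset_eq_permutation[of "sort (diag_mat D)" "diag_mat D"] lenD by auto
  \<comment> \<open>Eigenvalues are indexed from 1 and columns from 0.\<close>
  have "bij_betw (\<lambda>i. i - 1) {1..n} {..<n}" by (rule bij_betwI[where g = Suc]) auto
  then have bij: "bij_betw (\<lambda>i. p (i - 1)) {1..n} {..<n}"
    using bij_betw_trans permutes_imp_bij[OF p(1)] by (fastforce simp: o_def)
  have "eigenvector A (col P (p (i - 1))) (eig i A)" if i: "i \<in> {1..n}" for i
  proof -
    define j where "j = p (i - 1)"
    have j: "j < n" using bij_betwE[OF bij] i by (auto simp: j_def)
    have "i - 1 < n" using i by auto
    then have "eig i A = diag_mat D ! j"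
      unfolding eig p(2)[symmetric] using p(1) lenD by (subst permute_list_nth) (auto simp: j_def)
    then have e: "eig i A = D $$ (j, j)" using j D by (simp add: diag_mat_def)
    have "A *\<^sub>v col P j = col (P * D) j" unfolding PD using A P j by (intro eq_vecI) auto
    also have "\<dots> = D $$ (j, j) \<cdot>\<^sub>v col P j"
    proof (rule eq_vecI)
      fix k assume "k < dim_vec (D $$ (j, j) \<cdot>\<^sub>v col P j)"
      then have k: "k < n" using P by simp
      have "col (P * D) j $ k = (\<Sum>l = 0..<n. P $$ (k, l) * D $$ (l, j))"
        using k j P D by (simp add: scalar_prod_def)
      also have "\<dots> = (\<Sum>l = 0..<n. if l = j then P $$ (k, j) * D $$ (j, j) else 0)"
        using diag j D by (intro sum.cong) (auto simp: D_def[symmetric] diagonal_mat_def)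
      also have "\<dots> = P $$ (k, j) * D $$ (j, j)" using j by simp
      finally show "col (P * D) j $ k = (D $$ (j, j) \<cdot>\<^sub>v col P j) $ k" using k j P by simp
    qed (use P D in auto)
    finally have "A *\<^sub>v col P j = eig i A \<cdot>\<^sub>v col P j" by (simp add: e)
    moreover have "col P j \<noteq> 0\<^sub>v n"
      using col_scalar_prod_orthogonal[OF P j j] by auto
    ultimately show ?thesis unfolding j_def[symmetric] eigenvector_def using A P by auto
  qed
  then show ?thesis
    using orthonormal_basis_cols[OF P bij] unfolding ordered_eigenbasis_def by blast
qed

lemma ordered_eigenbasis_carrier:
  "ordered_eigenbasis n H u \<Longrightarrow> H \<in> carrier_mat n n \<Longrightarrow> i \<in> {1..n} \<Longrightarrow> u i \<in> carrier_vec n"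
  by (auto simp: ordered_eigenbasis_def eigenvector_def)

text \<open>A square matrix with orthonormal columns has orthonormal rows, and row \<open>k\<close>
  collects the coordinates at \<open>k\<close> of all basis vectors.\<close>

lemma orthonormal_coordinates:
  assumes orth: "\<And>i j. i \<in> {1..n} \<Longrightarrow> j \<in> {1..n} \<Longrightarrow> u i \<bullet> u j = (if i = j then 1 else (0::real))"
    and carrier: "\<And>i. i \<in> {1..n} \<Longrightarrow> u i \<in> carrier_vec n" and k: "k < n"
  shows "(\<Sum>i = 1..n. (u i $ k)\<^sup>2) = 1"
proof -
  define U where "U = mat n n (\<lambda>(k, i). u (Suc i) $ k)"
  have U: "U \<in> carrier_mat n n" by (simp add: U_def)
  then have Ut: "transpose_mat U \<in> carrier_mat n n" by simp
  have "transpose_mat U * U = 1\<^sub>m n"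
  proof (rule eq_matI)
    fix i j assume "i < dim_row (1\<^sub>m n :: real mat)" "j < dim_col (1\<^sub>m n :: real mat)"
    then have ij: "i < n" "j < n" by auto
    have col: "col U i = u (Suc i)" if "i < n" for i
      using that carrier[of "Suc i"] by (intro eq_vecI) (auto simp: U_def)
    have "(transpose_mat U * U) $$ (i, j) = u (Suc i) \<bullet> u (Suc j)" using ij U col by simp
    then show "(transpose_mat U * U) $$ (i, j) = 1\<^sub>m n $$ (i, j)" using ij orth[of "Suc i" "Suc j"] by simp
  qed (use U in auto)
  then have "(U * transpose_mat U) $$ (k, k) = 1"
    using mat_mult_left_right_inverse[OF Ut U] k by simp
  then have "(\<Sum>i = 0..<n. (u (Suc i) $ k)\<^sup>2) = 1"
    using k U by (simp add: scalar_prod_def U_def power2_eq_square)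
  then show ?thesis by (simp add: sum.atLeast1_atMost_eq lessThan_atLeast0)
qed

text \<open>Double counting of the mass on \<open>Bad\<close>. A vector that is not delocalized has
  a coordinate of modulus at least \<open>\<epsilon>\<close>, necessarily at a bad vertex, hence
  mass at least \<open>\<epsilon>\<^sup>2\<close> there. All basis vectors together have mass
  exactly \<open>card Bad\<close> on \<open>Bad\<close>.\<close>

lemma card_delocalized_ge:
  assumes u: "ordered_eigenbasis n H u" and H: "H \<in> carrier_mat n n"
    and Bad: "Bad \<subseteq> {..<n}" and \<epsilon>: "0 < \<epsilon>"
    and small: "\<And>i k. i \<in> {1..n} \<Longrightarrow> k \<in> {..<n} - Bad \<Longrightarrow> \<bar>u i $ k\<bar> < \<epsilon>"
  shows "real n - card Bad / \<epsilon>\<^sup>2 \<le> card (delocalized n \<epsilon> u)"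
proof -
  note carrier = ordered_eigenbasis_carrier[OF u H]
  have orth: "\<And>i j. i \<in> {1..n} \<Longrightarrow> j \<in> {1..n} \<Longrightarrow> u i \<bullet> u j = (if i = j then 1 else 0)"
    using u by (auto simp: ordered_eigenbasis_def orthonormal_basis_def)
  define X where "X = {1..n} - delocalized n \<epsilon> u"
  have finBad: "finite Bad" using Bad finite_subset by blast
  have mass: "\<epsilon>\<^sup>2 \<le> (\<Sum>k\<in>Bad. (u i $ k)\<^sup>2)" if i: "i \<in> X" for i
  proof -
    have i': "i \<in> {1..n}" and "\<epsilon> \<le> sup_norm (u i)" using i by (auto simp: X_def delocalized_def)
    moreover have "sup_norm (u i) \<in> (\<lambda>k. \<bar>u i $ k\<bar>) ` {..<dim_vec (u i)}"
      unfolding sup_norm_def using i' carrier[OF i'] by (intro Max_in) (auto simp: lessThan_empty_iff)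
    ultimately obtain k where k: "k < n" "\<epsilon> \<le> \<bar>u i $ k\<bar>" using carrier[OF i'] by auto
    then have "k \<in> Bad" using small[OF i', of k] by force
    have "\<epsilon>\<^sup>2 \<le> (u i $ k)\<^sup>2" using k \<epsilon> abs_le_square_iff[of \<epsilon> "u i $ k"] by simp
    also have "\<dots> \<le> (\<Sum>k\<in>Bad. (u i $ k)\<^sup>2)"
      using \<open>k \<in> Bad\<close> finBad by (intro member_le_sum) auto
    finally show ?thesis .
  qed
  have "card X * \<epsilon>\<^sup>2 \<le> (\<Sum>i\<in>X. \<Sum>k\<in>Bad. (u i $ k)\<^sup>2)" using sum_mono[of X, OF mass] by simp
  also have "\<dots> \<le> (\<Sum>i = 1..n. \<Sum>k\<in>Bad. (u i $ k)\<^sup>2)"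
    by (intro sum_mono2) (auto simp: X_def intro: sum_nonneg)
  also have "\<dots> = (\<Sum>k\<in>Bad. \<Sum>i = 1..n. (u i $ k)\<^sup>2)" by (rule sum.swap)
  also have "\<dots> = (\<Sum>k\<in>Bad. 1)"
    using Bad by (intro sum.cong orthonormal_coordinates[OF orth carrier]) auto
  finally have "card X \<le> card Bad / \<epsilon>\<^sup>2" using \<epsilon> by (simp add: pos_le_divide_eq)
  moreover have "card {1..n} = card (delocalized n \<epsilon> u) + card X"
  proof -
    have "delocalized n \<epsilon> u \<subseteq> {1..n}" by (auto simp: delocalized_def)
    then show ?thesis
      unfolding X_def using card_mono[of "{1..n}"] finite_subset[of _ "{1..n}"]
      by (simp add: card_Diff_subset)
  qed
  ultimately show ?thesis by simp
qed

subsection \<open>Concentration for the random graph\<close>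

text \<open>For \<open>s = - r\<close> negative the claim is
  \<open>1 \<le> (1 - r + r\<^sup>2) * exp r\<close>. With the quadratic Taylor bound for
  \<open>exp r\<close> the product expands to 1 plus nonnegative terms.\<close>

lemma exp_le_quadratic:
  fixes s :: real
  assumes "\<bar>s\<bar> \<le> 1"
  shows "exp s \<le> 1 + s + s\<^sup>2"
proof (cases "0 \<le> s")
  case True
  then show ?thesis using assms exp_bound[of s] by simp
next
  case False
  define r where "r = - s"
  have r: "0 < r" using False by (simp add: r_def)
  have "1 + r + r\<^sup>2 / 2 \<le> exp r" using exp_lower_Taylor_quadratic[of r] r by simp
  moreover have "0 \<le> 1 - r + r\<^sup>2"
    using zero_le_power2[of "r - 1/2"] by (simp add: power2_eq_square algebra_simps)
  ultimately have "(1 - r + r\<^sup>2) * (1 + r + r\<^sup>2 / 2) \<le> (1 - r + r\<^sup>2) * exp r" by (rule mult_left_mono)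
  moreover have "(1 - r + r\<^sup>2) * (1 + r + r\<^sup>2 / 2) = 1 + r\<^sup>2 / 2 + r ^ 3 / 2 + r ^ 4 / 2"
    by (simp add: power2_eq_square power3_eq_cube power4_eq_xxxx field_simps)
  moreover have "0 \<le> r\<^sup>2 / 2 + r ^ 3 / 2 + r ^ 4 / 2" using r by simp
  ultimately have "1 \<le> (1 - r + r\<^sup>2) * exp r" by linarith
  then have "exp s \<le> 1 - r + r\<^sup>2" by (simp add: r_def exp_minus field_simps)
  then show ?thesis by (simp add: r_def)
qed

text \<open>Beyond the threshold all of \<open>\<bar>y\<bar>\<close> is kept and not only the excess
  over \<open>a\<close>, since it has to dominate the whole degree of an atypical vertex.\<close>

definition tail_part :: "real \<Rightarrow> real \<Rightarrow> real" where
  "tail_part a y = (if \<bar>y\<bar> \<le> a then 0 else \<bar>y\<bar>)"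

lemma tail_part_nonneg [simp]: "0 \<le> tail_part a y"
  by (simp add: tail_part_def)

lemma tail_part_le: "tail_part a y \<le> \<bar>y\<bar>"
  by (simp add: tail_part_def)

lemma tail_part_measurable [measurable]: "tail_part a \<in> borel_measurable borel"
  unfolding tail_part_def by measurable

text \<open>For \<open>\<bar>y\<bar> > a\<close> one has
  \<open>t * \<bar>y\<bar> \<le> 2 * t * \<bar>y\<bar> - t * a\<close>: doubling the exponent buys
  the small factor \<open>exp (- t * a)\<close>.\<close>

lemma exp_tail_part_le:
  fixes t a y :: real
  assumes "0 \<le> t"
  shows "exp (t * tail_part a y) \<le> 1 + exp (- t * a) * (exp (2 * t * y) + exp (- (2 * t) * y))"
proof (cases "\<bar>y\<bar> \<le> a")
  case False
  have "exp (t * \<bar>y\<bar>) \<le> exp (- t * a) * exp (2 * t * \<bar>y\<bar>)"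
    using False assms mult_left_mono[of a "\<bar>y\<bar>" t] by (simp add: exp_add[symmetric])
  also have "\<dots> \<le> exp (- t * a) * (exp (2 * t * y) + exp (- (2 * t) * y))"
    by (intro mult_left_mono) (auto simp: abs_if)
  finally show ?thesis using False by (simp add: tail_part_def)
qed (simp add: tail_part_def)

section \<open>Chernoff bounds for independent Bernoulli variables\<close>

locale bernoulli_family = prob_space M for M :: "'w measure" +
  fixes X :: "'i \<Rightarrow> 'w \<Rightarrow> real" and I :: "'i set" and p :: real
  assumes indep: "indep_vars (\<lambda>_. borel) X I"
    and X01: "e \<in> I \<Longrightarrow> \<omega> \<in> space M \<Longrightarrow> X e \<omega> \<in> {0, 1}"
    and prob_1: "e \<in> I \<Longrightarrow> prob {\<omega>\<in>space M. X e \<omega> = 1} = p"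
    and prob_0: "e \<in> I \<Longrightarrow> prob {\<omega>\<in>space M. X e \<omega> = 0} = 1 - p"
    and p: "0 \<le> p" "p \<le> 1"
begin

lemma X_measurable: "e \<in> I \<Longrightarrow> X e \<in> borel_measurable M"
  using indep by (auto simp: indep_vars_def)

lemma prob_all_ones:
  assumes "J \<subseteq> I" "finite J"
  shows "prob {\<omega>\<in>space M. \<forall>e\<in>J. X e \<omega> = 1} = p ^ card J"
proof (cases "J = {}")
  case True
  then show ?thesis by (simp add: prob_space)
next
  case False
  have "{\<omega>\<in>space M. \<forall>e\<in>J. X e \<omega> = 1} = (\<Inter>e\<in>J. X e -` {1} \<inter> space M)" using False by auto
  also have "prob \<dots> = (\<Prod>e\<in>J. prob (X e -` {1} \<inter> space M))"
    using False assms by (intro indep_varsD[OF indep]) auto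
  also have "\<dots> = (\<Prod>e\<in>J. p)"
    using assms prob_1 by (intro prod.cong) (auto simp: vimage_def Int_def conj_commute)
  finally show ?thesis by simp
qed

lemma sets_all_ones: "J \<subseteq> I \<Longrightarrow> finite J \<Longrightarrow> {\<omega>\<in>space M. \<forall>e\<in>J. X e \<omega> = 1} \<in> events"
  using X_measurable by (intro sets.sets_Collect_finite_All borel_measurable_eq) auto

definition centred_sum :: "'i set \<Rightarrow> 'w \<Rightarrow> real" where
  "centred_sum K \<omega> = (\<Sum>e\<in>K. (X e \<omega> - p))"

lemma centred_sum_measurable: "K \<subseteq> I \<Longrightarrow> centred_sum K \<in> borel_measurable M"
  unfolding centred_sum_def using X_measurable by (intro borel_measurable_sum borel_measurable_diff) auto

lemma abs_centred_sum_le: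
  assumes "K \<subseteq> I" "\<omega> \<in> space M"
  shows "\<bar>centred_sum K \<omega>\<bar> \<le> card K"
proof -
  have "\<bar>centred_sum K \<omega>\<bar> \<le> (\<Sum>e\<in>K. \<bar>X e \<omega> - p\<bar>)" unfolding centred_sum_def by (rule sum_abs)
  also have "\<dots> \<le> (\<Sum>e\<in>K. 1)"
  proof (rule sum_mono)
    fix e assume "e \<in> K"
    then have "X e \<omega> \<in> {0, 1}" using assms X01 by blast
    then show "\<bar>X e \<omega> - p\<bar> \<le> 1" using p by auto
  qed
  finally show ?thesis by simp
qed

lemma integrable_bounded_fun:
  fixes f :: "real \<Rightarrow> real"
  assumes "K \<subseteq> I" "f \<in> borel_measurable borel" "\<And>y. \<bar>y\<bar> \<le> real (card K) \<Longrightarrow> \<bar>f y\<bar> \<le> B"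
  shows "integrable M (\<lambda>\<omega>. f (centred_sum K \<omega>))"
proof (rule integrable_const_bound)
  show "AE \<omega> in M. norm (f (centred_sum K \<omega>)) \<le> B"
    using assms abs_centred_sum_le by auto
qed (use centred_sum_measurable[OF assms(1)] assms(2) in measurable)

lemma integrable_exp_centred_sum: "K \<subseteq> I \<Longrightarrow> integrable M (\<lambda>\<omega>. exp (s * centred_sum K \<omega>))"
proof (rule integrable_bounded_fun[where f = "\<lambda>y. exp (s * y)"])
  fix y :: real assume "\<bar>y\<bar> \<le> card K"
  then have "s * y \<le> \<bar>s\<bar> * card K" by (metis abs_le_D1 abs_mult mult_left_mono abs_ge_zero order_trans abs_ge_self)
  then show "\<bar>exp (s * y)\<bar> \<le> exp (\<bar>s\<bar> * card K)" by simp
qed auto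

text \<open>The moment without centring is
  \<open>1 + p * (exp s - 1) \<le> exp (p * (s + s\<^sup>2))\<close>; centring cancels the linear
  term.\<close>

lemma mgf_single:
  fixes s :: real
  assumes e: "e \<in> I" and s: "\<bar>s\<bar> \<le> 1"
  shows "expectation (\<lambda>\<omega>. exp (s * (X e \<omega> - p))) \<le> exp (p * s\<^sup>2)"
proof -
  note [measurable] = X_measurable[OF e]
  have "expectation (\<lambda>\<omega>. exp (s * (X e \<omega> - p)))
      = expectation (\<lambda>\<omega>. exp (s * (1 - p)) * indicator {\<omega>\<in>space M. X e \<omega> = 1} \<omega>
          + exp (- s * p) * indicator {\<omega>\<in>space M. X e \<omega> = 0} \<omega>)"
  proof (rule Bochner_Integration.integral_cong)
    fix \<omega> assume "\<omega> \<in> space M"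
    with X01[OF e this] show "exp (s * (X e \<omega> - p)) = exp (s * (1 - p)) * indicator {\<omega>\<in>space M. X e \<omega> = 1} \<omega>
          + exp (- s * p) * indicator {\<omega>\<in>space M. X e \<omega> = 0} \<omega>" by auto
  qed simp
  also have "\<dots> = exp (s * (1 - p)) * p + exp (- s * p) * (1 - p)"
  proof -
    have "integrable M (indicat_real {\<omega>\<in>space M. X e \<omega> = c})" for c
      by (rule integrable_real_indicator) (simp_all add: less_top[symmetric])
    then show ?thesis using prob_1[OF e] prob_0[OF e] by (subst Bochner_Integration.integral_add) auto
  qed
  also have "\<dots> = exp (- s * p) * (1 + p * (exp s - 1))"
    by (simp add: algebra_simps exp_add[symmetric])
  also have "\<dots> \<le> exp (- s * p) * exp (p * (s + s\<^sup>2))"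
  proof (rule mult_left_mono)
    have "1 + p * (exp s - 1) \<le> 1 + p * (s + s\<^sup>2)"
      using exp_le_quadratic[OF s] p by (intro add_left_mono mult_left_mono) auto
    also have "\<dots> \<le> exp (p * (s + s\<^sup>2))" by (rule exp_ge_add_one_self)
    finally show "1 + p * (exp s - 1) \<le> exp (p * (s + s\<^sup>2))" .
  qed simp
  also have "\<dots> = exp (p * s\<^sup>2)" by (simp add: exp_add[symmetric] algebra_simps)
  finally show ?thesis .
qed

lemma mgf_centred_sum:
  fixes s :: real
  assumes K: "K \<subseteq> I" "finite K" and s: "\<bar>s\<bar> \<le> 1"
  shows "expectation (\<lambda>\<omega>. exp (s * centred_sum K \<omega>)) \<le> exp (p * s\<^sup>2 * card K)"
proof -
  have "expectation (\<lambda>\<omega>. exp (s * centred_sum K \<omega>)) = expectation (\<lambda>\<omega>. \<Prod>e\<in>K. exp (s * (X e \<omega> - p)))"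
    by (simp add: centred_sum_def sum_distrib_left exp_sum[OF K(2)])
  also have "\<dots> = (\<Prod>e\<in>K. expectation (\<lambda>\<omega>. exp (s * (X e \<omega> - p))))"
  proof (rule indep_vars_lebesgue_integral[OF K(2)])
    show "indep_vars (\<lambda>_. borel) (\<lambda>e \<omega>. exp (s * (X e \<omega> - p))) K"
      by (rule indep_vars_compose2[OF indep_vars_subset[OF indep K(1)]]) auto
    show "integrable M (\<lambda>\<omega>. exp (s * (X e \<omega> - p)))" if "e \<in> K" for e
      using integrable_exp_centred_sum[of "{e}" s] that K by (auto simp: centred_sum_def)
  qed
  also have "\<dots> \<le> (\<Prod>e\<in>K. exp (p * s\<^sup>2))"
    using K mgf_single[OF _ s] by (intro prod_mono) (auto intro!: integral_nonneg)
  also have "\<dots> = exp (p * s\<^sup>2 * card K)" by (simp add: exp_of_nat_mult mult.commute)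
  finally show ?thesis .
qed

lemma mgf_tail_part:
  fixes t a :: real
  assumes K: "K \<subseteq> I" "finite K" and t: "0 \<le> t" "2 * t \<le> 1"
  shows "expectation (\<lambda>\<omega>. exp (t * tail_part a (centred_sum K \<omega>))) \<le> 1 + 2 * exp (4 * t\<^sup>2 * p * card K - t * a)"
proof -
  note int = integrable_exp_centred_sum[OF K(1)]
  have "expectation (\<lambda>\<omega>. exp (t * tail_part a (centred_sum K \<omega>)))
      \<le> expectation (\<lambda>\<omega>. 1 + exp (- t * a) * (exp (2 * t * centred_sum K \<omega>) + exp (- (2 * t) * centred_sum K \<omega>)))"
  proof (rule integral_mono)
    show "integrable M (\<lambda>\<omega>. exp (t * tail_part a (centred_sum K \<omega>)))"
    proof (rule integrable_bounded_fun[OF K(1), where f = "\<lambda>y. exp (t * tail_part a y)" and B = "exp (t * card K)"])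
      show "\<bar>exp (t * tail_part a y)\<bar> \<le> exp (t * card K)" if "\<bar>y\<bar> \<le> card K" for y :: real
        using that tail_part_le[of a y] t by (auto intro!: mult_left_mono)
    qed measurable
    show "exp (t * tail_part a (centred_sum K \<omega>))
      \<le> 1 + exp (- t * a) * (exp (2 * t * centred_sum K \<omega>) + exp (- (2 * t) * centred_sum K \<omega>))" for \<omega>
      by (rule exp_tail_part_le[OF t(1)])
  qed (intro Bochner_Integration.integrable_add integrable_mult_right int, auto intro: int)
  also have "\<dots> = 1 + exp (- t * a) * (expectation (\<lambda>\<omega>. exp (2 * t * centred_sum K \<omega>))
      + expectation (\<lambda>\<omega>. exp (- (2 * t) * centred_sum K \<omega>)))"
    using int[of "2 * t"] int[of "- (2 * t)"] by (simp add: prob_space)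
  also have "\<dots> \<le> 1 + exp (- t * a) * (exp (p * (2 * t)\<^sup>2 * card K) + exp (p * (- (2 * t))\<^sup>2 * card K))"
    using t by (intro add_left_mono mult_left_mono add_mono mgf_centred_sum[OF K]) auto
  also have "\<dots> = 1 + 2 * exp (4 * t\<^sup>2 * p * card K - t * a)"
    by (simp add: exp_add[symmetric] exp_diff exp_minus field_simps power2_eq_square)
  finally show ?thesis .
qed

text \<open>Disjoint index sets make the tail parts independent over \<open>v\<close>, so the
  exponential moment of their sum factors. Each factor is at most
  \<open>1 + \<beta> \<le> exp \<beta>\<close>, and Markov's inequality contributes
  \<open>exp (- t * \<delta> * n)\<close>.\<close>

lemma sum_tail_part_deviation:
  fixes K :: "nat \<Rightarrow> 'i set" and n :: nat and lam t a \<delta> :: real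
  assumes K: "\<And>v. v < n \<Longrightarrow> K v \<subseteq> I" "\<And>v. v < n \<Longrightarrow> finite (K v)" "\<And>v. v < n \<Longrightarrow> p * card (K v) \<le> lam"
    and disj: "disjoint_family_on K {..<n}" and t: "0 \<le> t" "2 * t \<le> 1"
  defines "\<beta> \<equiv> 2 * exp (4 * t\<^sup>2 * lam - t * a)"
  shows "prob {\<omega>\<in>space M. \<delta> * n \<le> (\<Sum>v<n. tail_part a (centred_sum (K v) \<omega>))} \<le> exp (n * (\<beta> - t * \<delta>))"
proof -
  define Z where "Z v \<omega> = exp (t * tail_part a (centred_sum (K v) \<omega>))" for v \<omega>
  have intZ: "integrable M (Z v)" if "v < n" for v
    unfolding Z_def
  proof (rule integrable_bounded_fun[OF K(1)[OF that], where f = "\<lambda>y. exp (t * tail_part a y)" and B = "exp (t * card (K v))"])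
    show "\<bar>exp (t * tail_part a y)\<bar> \<le> exp (t * card (K v))" if "\<bar>y\<bar> \<le> card (K v)" for y :: real
      using that tail_part_le[of a y] t by (auto intro!: mult_left_mono)
  qed measurable
  \<comment> \<open>Independence passes to blocks: \<open>Z v\<close> is a measurable function of
    the variables indexed by \<open>K v\<close>.\<close>
  have indepZ: "indep_vars (\<lambda>_. borel) Z {..<n}"
  proof -
    have "indep_vars (\<lambda>v. PiM (K v) (\<lambda>_. borel)) (\<lambda>v \<omega>. restrict (\<lambda>e. X e \<omega>) (K v)) {..<n}"
      using K disj by (intro indep_vars_restrict[OF indep]) auto
    then have "indep_vars (\<lambda>_. borel)
        (\<lambda>v \<omega>. (\<lambda>f. exp (t * tail_part a (\<Sum>e\<in>K v. (f e - p)))) (restrict (\<lambda>e. X e \<omega>) (K v))) {..<n}"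
      by (rule indep_vars_compose2) measurable
    then show ?thesis by (simp add: Z_def[abs_def] centred_sum_def cong: sum.cong)
  qed
  have prod: "(\<Prod>v<n. Z v \<omega>) = exp (t * (\<Sum>v<n. tail_part a (centred_sum (K v) \<omega>)))" for \<omega>
    by (simp add: Z_def exp_sum sum_distrib_left)
  have int: "integrable M (\<lambda>\<omega>. \<Prod>v<n. Z v \<omega>)"
    by (rule indep_vars_integrable[OF _ indepZ intZ]) auto
  have "{\<omega>\<in>space M. \<delta> * n \<le> (\<Sum>v<n. tail_part a (centred_sum (K v) \<omega>))}
      \<subseteq> {\<omega>\<in>space M. exp (t * (\<delta> * n)) \<le> (\<Prod>v<n. Z v \<omega>)}"
    unfolding prod using t by (auto intro: mult_left_mono)
  then have "prob {\<omega>\<in>space M. \<delta> * n \<le> (\<Sum>v<n. tail_part a (centred_sum (K v) \<omega>))}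
      \<le> prob {\<omega>\<in>space M. exp (t * (\<delta> * n)) \<le> (\<Prod>v<n. Z v \<omega>)}"
    using borel_measurable_integrable[OF int] by (intro finite_measure_mono) auto
  also have "\<dots> \<le> expectation (\<lambda>\<omega>. \<Prod>v<n. Z v \<omega>) / exp (t * (\<delta> * n))"
    by (rule integral_Markov_inequality_measure[OF int, of "{}"]) (auto simp: Z_def intro!: prod_nonneg)
  also have "expectation (\<lambda>\<omega>. \<Prod>v<n. Z v \<omega>) = (\<Prod>v<n. expectation (Z v))"
    by (rule indep_vars_lebesgue_integral[OF _ indepZ intZ]) auto
  also have "\<dots> \<le> (\<Prod>v<n. exp \<beta>)"
  proof (intro prod_mono conjI)
    fix v assume "v \<in> {..<n}"
    then have v: "v < n" by simp
    have "expectation (Z v) \<le> 1 + 2 * exp (4 * t\<^sup>2 * p * card (K v) - t * a)"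
      unfolding Z_def[abs_def] using K v t by (intro mgf_tail_part) auto
    also have "\<dots> \<le> 1 + \<beta>"
      unfolding \<beta>_def using mult_left_mono[OF K(3)[OF v], of "4 * t\<^sup>2"] by (simp add: mult.assoc)
    also have "\<dots> \<le> exp \<beta>" by (rule exp_ge_add_one_self)
    finally show "expectation (Z v) \<le> exp \<beta>" .
  qed (auto simp: Z_def)
  also have "(\<Prod>v<n. exp \<beta>) / exp (t * (\<delta> * n)) = exp (n * (\<beta> - t * \<delta>))"
    by (simp add: exp_of_nat_mult[symmetric] exp_diff[symmetric] algebra_simps)
  finally show ?thesis by (simp add: divide_right_mono)
qed

end


section \<open>Edge sets of potential lollipops and of their disjoint pairs\<close>

definition edge_index :: "nat \<Rightarrow> nat \<Rightarrow> nat \<times> nat" where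
  "edge_index a b = (max a b, min a b)"

lemma edge_index_eq_iff: "edge_index a b = edge_index c d \<longleftrightarrow> a = c \<and> b = d \<or> a = d \<and> b = c"
  by (auto simp: edge_index_def max_def min_def split: if_splits)

definition lollipop_edges :: "nat list \<Rightarrow> nat \<Rightarrow> (nat \<times> nat) set" where
  "lollipop_edges zs c = insert (edge_index (zs ! 0) (zs ! c))
     ((\<lambda>i. edge_index (zs ! i) (zs ! Suc i)) ` {..<length zs - 1})"

lemma finite_lollipop_edges [simp]: "finite (lollipop_edges zs c)"
  by (simp add: lollipop_edges_def)

text \<open>Having as many edges as vertices is decisive: at most \<open>n ^ a\<close> placements of
  \<open>a\<close> vertices meet the probability \<open>p ^ a\<close>, so the expected number is
  bounded for fixed \<open>n * p\<close>.\<close>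

lemma card_lollipop_edges:
  assumes "distinct zs" "2 \<le> c" "c < length zs"
  shows "card (lollipop_edges zs c) = length zs"
proof -
  have "inj_on (\<lambda>i. edge_index (zs ! i) (zs ! Suc i)) {..<length zs - 1}"
    using assms by (auto simp: inj_on_def edge_index_eq_iff nth_eq_iff_index_eq)
  moreover have "edge_index (zs ! 0) (zs ! c) \<notin> (\<lambda>i. edge_index (zs ! i) (zs ! Suc i)) ` {..<length zs - 1}"
  proof
    assume "edge_index (zs ! 0) (zs ! c) \<in> (\<lambda>i. edge_index (zs ! i) (zs ! Suc i)) ` {..<length zs - 1}"
    then obtain i where "i < length zs - 1" and "edge_index (zs ! 0) (zs ! c) = edge_index (zs ! i) (zs ! Suc i)"
      by blast
    then have i: "Suc i < length zs"
      and eq: "zs ! 0 = zs ! i \<and> zs ! c = zs ! Suc i \<or> zs ! 0 = zs ! Suc i \<and> zs ! c = zs ! i"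
      unfolding edge_index_eq_iff by auto
    have nth: "zs ! j = zs ! k \<Longrightarrow> j < length zs \<Longrightarrow> k < length zs \<Longrightarrow> j = k" for j k
      using assms(1) by (simp add: nth_eq_iff_index_eq)
    \<comment> \<open>In the first case the closing edge would be the path edge with
      \<open>i = 0\<close> and \<open>c = 1\<close>, excluded by \<open>2 \<le> c\<close>; in the
      second, index 0 would be a successor.\<close>
    from eq show False
    proof (elim disjE conjE)
      assume *: "zs ! 0 = zs ! i" "zs ! c = zs ! Suc i"
      have "0 = i" by (rule nth[OF *(1)]) (use i in linarith)+
      moreover have "c = Suc i" by (rule nth[OF *(2) assms(3) i])
      ultimately show False using assms(2) by linarith
    next
      assume *: "zs ! 0 = zs ! Suc i"
      have "0 = Suc i" by (rule nth[OF * _ i]) (use i in linarith)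
      then show False by simp
    qed
  qed
  ultimately show ?thesis using assms by (simp add: lollipop_edges_def card_image)
qed

text \<open>One end of an edge suffices to see that lollipops with disjoint vertex sets share no
  edge.\<close>

lemma lollipop_edges_fst:
  assumes "c < length zs" "(a, b) \<in> lollipop_edges zs c"
  shows "a \<in> set zs"
proof -
  obtain i j where "i < length zs" "j < length zs" "(a, b) = edge_index (zs ! i) (zs ! j)"
  proof (cases "(a, b) = edge_index (zs ! 0) (zs ! c)")
    case True
    moreover have "0 < length zs" using assms(1) by linarith
    ultimately show ?thesis using that assms(1) by blast
  next
    case False
    then obtain i where "i < length zs - 1" "(a, b) = edge_index (zs ! i) (zs ! Suc i)"
      using assms(2) unfolding lollipop_edges_def by blast
    with that[of i "Suc i"] show ?thesis by auto
  qed
  then show ?thesis by (auto simp: edge_index_def max_def)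
qed

lemma lollipop_edges_subset:
  assumes "distinct zs" "2 \<le> c" "c < length zs" "set zs \<subseteq> {..<n}"
  shows "lollipop_edges zs c \<subseteq> {(i, j). j < i \<and> i < n}"
proof -
  have E: "edge_index (zs ! i) (zs ! j) \<in> {(i, j). j < i \<and> i < n}"
    if "i < length zs" "j < length zs" "i \<noteq> j" for i j
  proof -
    have "zs ! i < n" "zs ! j < n" using assms(4) that nth_mem by blast+
    moreover have "zs ! i \<noteq> zs ! j" using assms(1) that by (simp add: nth_eq_iff_index_eq)
    ultimately show ?thesis by (auto simp: edge_index_def)
  qed
  have E0: "edge_index (zs ! 0) (zs ! c) \<in> {(i, j). j < i \<and> i < n}" using assms(2,3) by (intro E) linarith+
  have E1: "edge_index (zs ! i) (zs ! Suc i) \<in> {(i, j). j < i \<and> i < n}" if "i < length zs - 1" for i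
    using that by (intro E) linarith+
  show ?thesis
    unfolding lollipop_edges_def
  proof (rule insert_subsetI[OF E0], rule image_subsetI)
    fix i assume "i \<in> {..<length zs - 1}"
    then show "edge_index (zs ! i) (zs ! Suc i) \<in> {(i, j). j < i \<and> i < n}" by (intro E1) simp
  qed
qed

definition lollipop_shapes :: "nat \<Rightarrow> nat \<Rightarrow> (nat list \<times> nat) set" where
  "lollipop_shapes n L = {(zs, c). distinct zs \<and> set zs \<subseteq> {..<n} \<and> 2 \<le> c \<and> c < length zs \<and> length zs \<le> L}"

lemma finite_lollipop_shapes: "finite (lollipop_shapes n L)"
proof (rule finite_subset)
  show "lollipop_shapes n L \<subseteq> {xs. set xs \<subseteq> {..<n} \<and> length xs \<le> L} \<times> {..<L}"
    by (auto simp: lollipop_shapes_def)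
qed (use finite_lists_length_le[of "{..<n}"] in blast)

text \<open>There are \<open>n ^ a\<close> vertex lists of length \<open>a\<close>, with
  distinctness dropped from the count, and at most \<open>L\<close> choices of
  \<open>c\<close>.\<close>

lemma sum_lollipop_shapes_le:
  fixes p :: real
  assumes "0 \<le> p"
  shows "(\<Sum>(zs, c)\<in>lollipop_shapes n L. p ^ length zs) \<le> L * (\<Sum>a\<le>L. (n * p) ^ a)"
proof -
  let ?S = "\<lambda>a. {xs. set xs \<subseteq> {..<n} \<and> length xs = a}"
  have fin: "finite (?S a)" for a using finite_lists_length_eq[of "{..<n}" a] by simp
  have "(\<Sum>(zs, c)\<in>lollipop_shapes n L. p ^ length zs) \<le> (\<Sum>(zs, c)\<in>(\<Union>a\<le>L. ?S a) \<times> {..<L}. p ^ length zs)"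
    using assms fin by (intro sum_mono2) (auto simp: lollipop_shapes_def)
  also have "\<dots> = (\<Sum>zs\<in>(\<Union>a\<le>L. ?S a). L * p ^ length zs)"
    by (subst sum.cartesian_product[symmetric]) simp
  also have "\<dots> = (\<Sum>a\<le>L. \<Sum>zs\<in>?S a. L * p ^ length zs)"
    using fin by (intro sum.UNION_disjoint) auto
  also have "\<dots> = (\<Sum>a\<le>L. \<Sum>zs\<in>?S a. L * p ^ a)" by (intro sum.cong) auto
  also have "\<dots> = L * (\<Sum>a\<le>L. (n * p) ^ a)"
    using card_lists_length_eq[of "{..<n}"] by (simp add: sum_distrib_left power_mult_distrib mult_ac)
  finally show ?thesis .
qed

definition shape_pairs :: "nat \<Rightarrow> nat \<Rightarrow> ((nat list \<times> nat) \<times> (nat list \<times> nat)) set" where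
  "shape_pairs n L = {(s, t) \<in> lollipop_shapes n L \<times> lollipop_shapes n L. set (fst s) \<inter> set (fst t) = {}}"

definition pair_edges :: "((nat list \<times> nat) \<times> (nat list \<times> nat)) \<Rightarrow> (nat \<times> nat) set" where
  "pair_edges = (\<lambda>((zs, c), (ys, b)). lollipop_edges zs c \<union> lollipop_edges ys b)"

lemma finite_shape_pairs: "finite (shape_pairs n L)"
  by (rule finite_subset[of _ "lollipop_shapes n L \<times> lollipop_shapes n L"])
    (auto simp: shape_pairs_def finite_lollipop_shapes)

lemma finite_pair_edges [simp]: "finite (pair_edges s)"
  by (auto simp: pair_edges_def split: prod.splits)

lemma pair_edges_subset:
  assumes "s \<in> shape_pairs n L"
  shows "pair_edges s \<subseteq> {(i, j). j < i \<and> i < n}"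
proof -
  obtain zs c ys b where s: "s = ((zs, c), (ys, b))" by (metis surj_pair)
  then have "lollipop_edges zs c \<subseteq> {(i, j). j < i \<and> i < n}" "lollipop_edges ys b \<subseteq> {(i, j). j < i \<and> i < n}"
    using assms by (intro lollipop_edges_subset; simp add: shape_pairs_def lollipop_shapes_def)+
  then show ?thesis unfolding s pair_edges_def by simp
qed

lemma card_pair_edges:
  assumes "((zs, c), (ys, b)) \<in> shape_pairs n L"
  shows "card (pair_edges ((zs, c), (ys, b))) = length zs + length ys"
proof -
  have "lollipop_edges zs c \<inter> lollipop_edges ys b = {}"
  proof (rule equals0I)
    fix e assume e: "e \<in> lollipop_edges zs c \<inter> lollipop_edges ys b"
    obtain x y where "e = (x, y)" by (cases e)
    with e assms have "x \<in> set zs" "x \<in> set ys"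
      using lollipop_edges_fst[of c zs x y] lollipop_edges_fst[of b ys x y]
      by (simp_all add: shape_pairs_def lollipop_shapes_def)
    with assms show False by (auto simp: shape_pairs_def)
  qed
  then show ?thesis
    using assms card_lollipop_edges[of zs c] card_lollipop_edges[of ys b]
    by (simp add: pair_edges_def card_Un_disjoint shape_pairs_def lollipop_shapes_def)
qed

section \<open>Degrees and lollipop counts of the random graph\<close>

locale random_graph = bernoulli_family M X "{(i, j). j < i \<and> i < n}" p
  for M :: "'w measure" and X :: "nat \<times> nat \<Rightarrow> 'w \<Rightarrow> real" and n :: nat and p :: real
begin

definition nbrs :: "'w \<Rightarrow> nat \<Rightarrow> nat set" where
  "nbrs \<omega> v = {y. v < n \<and> y < n \<and> v \<noteq> y \<and> X (edge_index v y) \<omega> = 1}"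

sublocale G: finite_graph "{..<n}" "nbrs \<omega>" for \<omega>
  by unfold_locales (auto simp: nbrs_def edge_index_def max.commute min.commute)

text \<open>Edges from \<open>v\<close> to smaller vertices form \<open>row v\<close>, those to
  larger ones \<open>column v\<close>. Different rows are disjoint and so are different columns,
  although the degrees of two vertices share an edge variable.\<close>

definition row :: "nat \<Rightarrow> (nat \<times> nat) set" where "row v = Pair v ` {..<v}"
definition column :: "nat \<Rightarrow> (nat \<times> nat) set" where "column v = (\<lambda>i. (i, v)) ` {v<..<n}"

lemma row_column:
  "v < n \<Longrightarrow> row v \<subseteq> {(i, j). j < i \<and> i < n}" "v < n \<Longrightarrow> column v \<subseteq> {(i, j). j < i \<and> i < n}"
  "finite (row v)" "finite (column v)" "card (row v) = v" "card (column v) = n - Suc v"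
  by (auto simp: row_def column_def card_image inj_on_def)

lemma card_nbrs:
  assumes \<omega>: "\<omega> \<in> space M" and v: "v < n"
  shows "card (nbrs \<omega> v) = p * (n - 1) + centred_sum (row v) \<omega> + centred_sum (column v) \<omega>"
proof -
  have ones: "(\<Sum>e\<in>K. X e \<omega>) = card {e\<in>K. X e \<omega> = 1}"
    if "K \<subseteq> {(i, j). j < i \<and> i < n}" "finite K" for K
  proof -
    have "(\<Sum>e\<in>K. X e \<omega>) = (\<Sum>e\<in>K. if X e \<omega> = 1 then 1 else 0)"
      using X01[OF _ \<omega>] that by (intro sum.cong) (auto dest!: subsetD)
    then show ?thesis using that(2) by (simp add: sum.If_cases Int_def)
  qed
  have "nbrs \<omega> v = {y\<in>{..<v}. X (v, y) \<omega> = 1} \<union> {y\<in>{v<..<n}. X (y, v) \<omega> = 1}"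
    using v by (auto simp: nbrs_def edge_index_def max_def min_def split: if_splits)
  then have "card (nbrs \<omega> v) = card {y\<in>{..<v}. X (v, y) \<omega> = 1} + card {y\<in>{v<..<n}. X (y, v) \<omega> = 1}"
    by (simp add: card_Un_disjoint disjoint_iff)
  also have "{y\<in>{..<v}. X (v, y) \<omega> = 1} = snd ` {e\<in>row v. X e \<omega> = 1}" by (force simp: row_def)
  also have "card \<dots> = card {e\<in>row v. X e \<omega> = 1}" by (rule card_image) (auto simp: row_def inj_on_def)
  also have "{y\<in>{v<..<n}. X (y, v) \<omega> = 1} = fst ` {e\<in>column v. X e \<omega> = 1}" by (force simp: column_def)
  also have "card \<dots> = card {e\<in>column v. X e \<omega> = 1}" by (rule card_image) (auto simp: column_def inj_on_def)
  finally have "real (card (nbrs \<omega> v)) = (\<Sum>e\<in>row v. X e \<omega>) + (\<Sum>e\<in>column v. X e \<omega>)"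
    using ones[of "row v"] ones[of "column v"] row_column v by simp
  moreover have "real (n - 1) = real v + real (n - Suc v)" using v by simp
  ultimately show ?thesis
    using row_column by (simp add: centred_sum_def sum_subtractf algebra_simps)
qed

text \<open>An atypical degree forces the larger modulus \<open>m\<close> of the two centred sums
  above \<open>a\<close>. The degree is then at most a multiple of \<open>m\<close>, and
  \<open>m\<close> is among the tail parts.\<close>

lemma atypical_degree_sum:
  fixes q \<eta> :: real
  assumes \<omega>: "\<omega> \<in> space M" and np: "n * p = q\<^sup>2"
    and \<eta>: "0 < \<eta>" "\<eta> \<le> 1" "1 \<le> \<eta> * q\<^sup>2" and n: "2 \<le> \<eta> * n"
  defines "a \<equiv> \<eta> * q\<^sup>2 / 4"
  shows "(\<Sum>v\<in>{..<n} - G.typical \<omega> q \<eta>. real (card (nbrs \<omega> v) + 1))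
    \<le> 10 / \<eta> * ((\<Sum>v<n. tail_part a (centred_sum (row v) \<omega>)) + (\<Sum>v<n. tail_part a (centred_sum (column v) \<omega>)))"
proof -
  have "(\<Sum>v\<in>{..<n} - G.typical \<omega> q \<eta>. real (card (nbrs \<omega> v) + 1))
    \<le> (\<Sum>v\<in>{..<n} - G.typical \<omega> q \<eta>. 10 / \<eta> * (tail_part a (centred_sum (row v) \<omega>) + tail_part a (centred_sum (column v) \<omega>)))"
  proof (rule sum_mono)
    fix v assume "v \<in> {..<n} - G.typical \<omega> q \<eta>"
    then have v: "v < n" and far: "\<bar>real (card (nbrs \<omega> v)) - q\<^sup>2\<bar> > \<eta> * q\<^sup>2"
      by (auto simp: G.typical_def)
    define y z where "y = centred_sum (row v) \<omega>" and "z = centred_sum (column v) \<omega>"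
    have deg: "card (nbrs \<omega> v) = q\<^sup>2 - p + y + z"
      using card_nbrs[OF \<omega> v] v np by (simp add: y_def z_def algebra_simps of_nat_diff)
    define m where "m = max \<bar>y\<bar> \<bar>z\<bar>"
    have m: "\<bar>y\<bar> \<le> m" "\<bar>z\<bar> \<le> m" by (auto simp: m_def)
    \<comment> \<open>The mean degree is \<open>q\<^sup>2 - p\<close>. The offset \<open>p\<close>
      uses at most half of the tolerance; \<open>y\<close> and \<open>z\<close> share the rest,
      hence the quarter in \<open>a\<close>.\<close>
    have "2 * p \<le> \<eta> * n * p" using n p by (intro mult_right_mono) auto
    also have "\<eta> * n * p = \<eta> * q\<^sup>2" by (simp add: np[symmetric])
    finally have "2 * p \<le> \<eta> * q\<^sup>2" .
    then have ma: "a < m" using far m p unfolding deg a_def by linarith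
    have "m \<le> tail_part a y + tail_part a z"
      using ma tail_part_nonneg[of a y] tail_part_nonneg[of a z]
      by (cases "\<bar>y\<bar> \<le> \<bar>z\<bar>") (auto simp: m_def tail_part_def split: if_splits)
    moreover have "real (card (nbrs \<omega> v) + 1) \<le> 10 / \<eta> * m"
    proof -
      \<comment> \<open>The constant 10 is 8 for the part \<open>q\<^sup>2 + 1\<close>, by
        \<open>\<eta> * q\<^sup>2 < 4 * m\<close>, plus 2 for the deviations.\<close>
      have "\<eta> * q\<^sup>2 \<le> q\<^sup>2" using \<eta> mult_right_mono[of \<eta> 1 "q\<^sup>2"] by simp
      then have "\<eta> * (q\<^sup>2 + 1) \<le> 2 * (\<eta> * q\<^sup>2)" using \<eta> by (simp add: algebra_simps)
      also have "\<dots> \<le> 8 * m" using ma by (simp add: a_def)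
      finally have 1: "\<eta> * (q\<^sup>2 + 1) \<le> 8 * m" .
      have "0 \<le> m" using m by linarith
      then have 2: "\<eta> * m \<le> m" using \<eta> mult_right_mono[of \<eta> 1 m] by simp
      have "real (card (nbrs \<omega> v) + 1) \<le> q\<^sup>2 + 1 + 2 * m" 
        using deg abs_le_D1[OF m(1)] abs_le_D1[OF m(2)] p unfolding of_nat_add of_nat_1 by linarith
      then have "\<eta> * real (card (nbrs \<omega> v) + 1) \<le> \<eta> * (q\<^sup>2 + 1 + 2 * m)" using \<eta> by (intro mult_left_mono) auto
      also have "\<dots> \<le> 10 * m" using 1 2 by (simp add: algebra_simps)
      finally show ?thesis using \<eta> by (simp add: field_simps)
    qed
    ultimately have "real (card (nbrs \<omega> v) + 1) \<le> 10 / \<eta> * (tail_part a y + tail_part a z)"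
      using \<eta> by (meson divide_nonneg_pos mult_left_mono order_trans zero_le_numeral)
    then show "real (card (nbrs \<omega> v) + 1)
      \<le> 10 / \<eta> * (tail_part a (centred_sum (row v) \<omega>) + tail_part a (centred_sum (column v) \<omega>))"
      by (simp add: y_def z_def)
  qed
  also have "\<dots> \<le> (\<Sum>v<n. 10 / \<eta> * (tail_part a (centred_sum (row v) \<omega>) + tail_part a (centred_sum (column v) \<omega>)))"
    using \<eta> by (intro sum_mono2) auto
  finally show ?thesis by (simp add: sum.distrib sum_distrib_left distrib_left)
qed

text \<open>A majorant of the number of lollipop pairs, written as a sum of indicators so that
  measurability and expectation can be treated term by term.\<close>

definition shape_hits :: "nat \<Rightarrow> 'w \<Rightarrow> real" where
  "shape_hits L \<omega> = (\<Sum>s\<in>shape_pairs n L. indicator {\<omega>\<in>space M. \<forall>e\<in>pair_edges s. X e \<omega> = 1} \<omega>)"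

lemma card_lollipop_pairs_le:
  assumes \<omega>: "\<omega> \<in> space M"
  shows "card (G.lollipop_pairs \<omega> L) \<le> shape_hits L \<omega>"
proof -
  have edge: "X (edge_index a b) \<omega> = 1" if "b \<in> nbrs \<omega> a" for a b using that by (simp add: nbrs_def)
  have lol: "(zs, c) \<in> lollipop_shapes n L \<and> (\<forall>e\<in>lollipop_edges zs c. X e \<omega> = 1)"
    if "G.lollipop \<omega> zs c" "length zs \<le> L" for zs c
  proof -
    have "X (edge_index (zs ! i) (zs ! Suc i)) \<omega> = 1" if "i < length zs - 1" for i
      using \<open>G.lollipop \<omega> zs c\<close> that successively_nth[of "\<lambda>a b. b \<in> nbrs \<omega> a" zs i]
      by (intro edge) (auto simp: G.lollipop_def)
    moreover have "X (edge_index (zs ! 0) (zs ! c)) \<omega> = 1"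
      using that by (intro edge) (cases zs, auto simp: G.lollipop_def)
    ultimately show ?thesis
      using that by (auto simp: lollipop_shapes_def lollipop_edges_def G.lollipop_def)
  qed
  have "G.lollipop_pairs \<omega> L \<subseteq> {s\<in>shape_pairs n L. \<forall>e\<in>pair_edges s. X e \<omega> = 1}"
  proof (rule subsetI)
    fix s assume "s \<in> G.lollipop_pairs \<omega> L"
    then obtain zs c ys b where s: "s = ((zs, c), (ys, b))" "G.lollipop \<omega> zs c" "G.lollipop \<omega> ys b"
      "length zs \<le> L" "length ys \<le> L" "set zs \<inter> set ys = {}"
      by (auto simp: G.lollipop_pairs_def)
    then show "s \<in> {s\<in>shape_pairs n L. \<forall>e\<in>pair_edges s. X e \<omega> = 1}"
      using lol[of zs c] lol[of ys b] by (auto simp: shape_pairs_def pair_edges_def)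
  qed
  then have "card (G.lollipop_pairs \<omega> L) \<le> card {s\<in>shape_pairs n L. \<forall>e\<in>pair_edges s. X e \<omega> = 1}"
    using finite_shape_pairs by (intro card_mono) auto
  also have "real (card {s\<in>shape_pairs n L. \<forall>e\<in>pair_edges s. X e \<omega> = 1}) = shape_hits L \<omega>"
    using \<omega> finite_shape_pairs[of n L]
    by (simp add: shape_hits_def indicator_def sum.If_cases Int_def)
  finally show ?thesis by simp
qed

lemma shape_hits_measurable [measurable]: "shape_hits L \<in> borel_measurable M"
  unfolding shape_hits_def
  by (intro borel_measurable_sum borel_measurable_indicator sets_all_ones pair_edges_subset) auto

text \<open>By independence of the edges the expectation is at most the square of the sum for a
  single lollipop, which depends on \<open>n\<close> only through \<open>n * p\<close>. With
  \<open>x\<close> of order \<open>n\<^sup>2\<close> Markov's inequality becomes summable in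
  \<open>n\<close>.\<close>

lemma prob_shape_hits:
  assumes x: "0 < x"
  shows "prob {\<omega>\<in>space M. x \<le> shape_hits L \<omega>} \<le> (L * (\<Sum>a\<le>L. (n * p) ^ a))\<^sup>2 / x"
proof -
  let ?E = "\<lambda>s. {\<omega>\<in>space M. \<forall>e\<in>pair_edges s. X e \<omega> = 1}"
  have ev: "?E s \<in> events" if "s \<in> shape_pairs n L" for s
    using pair_edges_subset[OF that] by (intro sets_all_ones) auto
  have int: "integrable M (indicat_real (?E s))" if "s \<in> shape_pairs n L" for s
    using ev[OF that] by (intro integrable_real_indicator) (simp_all add: less_top[symmetric])
  have intH: "integrable M (shape_hits L)"
    unfolding shape_hits_def by (intro Bochner_Integration.integrable_sum int)
  have "expectation (shape_hits L) = (\<Sum>s\<in>shape_pairs n L. prob (?E s))"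
    unfolding shape_hits_def using int ev by (subst Bochner_Integration.integral_sum) auto
  also have "\<dots> = (\<Sum>((zs, c), (ys, b))\<in>shape_pairs n L. p ^ length zs * p ^ length ys)"
  proof (intro sum.cong refl)
    fix s assume s: "s \<in> shape_pairs n L"
    obtain zs c ys b where "s = ((zs, c), (ys, b))" by (metis surj_pair)
    then show "prob (?E s) = (\<lambda>((zs, c), (ys, b)). p ^ length zs * p ^ length ys) s"
      using s prob_all_ones[OF pair_edges_subset[OF s]] card_pair_edges by (simp add: power_add)
  qed
  \<comment> \<open>Dropping disjointness adds only nonnegative terms and makes the sum a
    square.\<close>
  also have "\<dots> \<le> (\<Sum>((zs, c), (ys, b))\<in>lollipop_shapes n L \<times> lollipop_shapes n L. p ^ length zs * p ^ length ys)"
    using p finite_lollipop_shapes by (intro sum_mono2) (auto simp: shape_pairs_def)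
  also have "\<dots> = (\<Sum>(zs, c)\<in>lollipop_shapes n L. p ^ length zs)\<^sup>2"
    unfolding power2_eq_square sum_product sum.cartesian_product by (intro sum.cong) auto
  also have "\<dots> \<le> (L * (\<Sum>a\<le>L. (n * p) ^ a))\<^sup>2"
    using p by (intro power_mono sum_lollipop_shapes_le sum_nonneg) auto
  finally have "expectation (shape_hits L) / x \<le> (L * (\<Sum>a\<le>L. (n * p) ^ a))\<^sup>2 / x"
    using x by (intro divide_right_mono) auto
  moreover have "prob {\<omega>\<in>space M. x \<le> shape_hits L \<omega>} \<le> expectation (shape_hits L) / x"
    by (rule integral_Markov_inequality_measure[OF intH, of "{}"])
      (use x in \<open>auto simp: shape_hits_def intro!: sum_nonneg\<close>)
  ultimately show ?thesis by linarith
qed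

end

subsection \<open>Almost sure delocalization\<close>

context random_graph
begin

text \<open>The third threshold is quadratic in \<open>n\<close> because the square root of the pair
  count enters the bound on bad vertices.\<close>

definition failure :: "real \<Rightarrow> real \<Rightarrow> real \<Rightarrow> nat \<Rightarrow> 'w set" where
  "failure a \<delta> \<theta> L =
     {\<omega>\<in>space M. \<delta> * n \<le> (\<Sum>v<n. tail_part a (centred_sum (row v) \<omega>))} \<union>
     {\<omega>\<in>space M. \<delta> * n \<le> (\<Sum>v<n. tail_part a (centred_sum (column v) \<omega>))} \<union>
     {\<omega>\<in>space M. \<theta> * (real n)\<^sup>2 \<le> shape_hits L \<omega>}"

lemma tail_sum_measurable:
  assumes "\<And>v. v < n \<Longrightarrow> K v \<subseteq> {(i, j). j < i \<and> i < n}"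
  shows "(\<lambda>\<omega>. \<Sum>v<n. tail_part a (centred_sum (K v) \<omega>)) \<in> borel_measurable M"
proof (rule borel_measurable_sum)
  fix v assume "v \<in> {..<n}"
  then have [measurable]: "centred_sum (K v) \<in> borel_measurable M"
    using assms by (intro centred_sum_measurable) auto
  show "(\<lambda>\<omega>. tail_part a (centred_sum (K v) \<omega>)) \<in> borel_measurable M" by measurable
qed

lemma failure_events:
  fixes a \<delta> \<theta> :: real
  shows
  "{\<omega>\<in>space M. \<delta> * n \<le> (\<Sum>v<n. tail_part a (centred_sum (row v) \<omega>))} \<in> events"
  "{\<omega>\<in>space M. \<delta> * n \<le> (\<Sum>v<n. tail_part a (centred_sum (column v) \<omega>))} \<in> events"
  "{\<omega>\<in>space M. \<theta> * (real n)\<^sup>2 \<le> shape_hits L \<omega>} \<in> events"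
  "failure a \<delta> \<theta> L \<in> events"
proof -
  note [measurable] = tail_sum_measurable[of row, OF row_column(1)] tail_sum_measurable[of column, OF row_column(2)]
  show 1: "{\<omega>\<in>space M. \<delta> * n \<le> (\<Sum>v<n. tail_part a (centred_sum (row v) \<omega>))} \<in> events"
    and 2: "{\<omega>\<in>space M. \<delta> * n \<le> (\<Sum>v<n. tail_part a (centred_sum (column v) \<omega>))} \<in> events"
    and 3: "{\<omega>\<in>space M. \<theta> * (real n)\<^sup>2 \<le> shape_hits L \<omega>} \<in> events" by measurable
  show "failure a \<delta> \<theta> L \<in> events" unfolding failure_def using 1 2 3 by blast
qed

lemma prob_failure:
  fixes a \<delta> \<theta> t :: real
  assumes t: "0 \<le> t" "2 * t \<le> 1" and \<theta>: "0 < \<theta>" and n: "0 < n"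
  defines "\<beta> \<equiv> 2 * exp (4 * t\<^sup>2 * (n * p) - t * a)"
  shows "prob (failure a \<delta> \<theta> L)
    \<le> 2 * exp (n * (\<beta> - t * \<delta>)) + (L * (\<Sum>a\<le>L. (n * p) ^ a))\<^sup>2 / (\<theta> * (real n)\<^sup>2)"
proof -
  let ?R = "{\<omega>\<in>space M. \<delta> * n \<le> (\<Sum>v<n. tail_part a (centred_sum (row v) \<omega>))}"
  let ?C = "{\<omega>\<in>space M. \<delta> * n \<le> (\<Sum>v<n. tail_part a (centred_sum (column v) \<omega>))}"
  let ?H = "{\<omega>\<in>space M. \<theta> * (real n)\<^sup>2 \<le> shape_hits L \<omega>}"
  have le: "p * real k \<le> n * p" if "k \<le> n" for k using that p by (simp add: mult.commute mult_left_mono)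
  have card_le: "p * card (row v) \<le> n * p" "p * card (column v) \<le> n * p" if "v < n" for v
    unfolding row_column by (rule le, use that in simp)+
  have disj: "disjoint_family_on row {..<n}" "disjoint_family_on column {..<n}"
    by (auto simp: disjoint_family_on_def row_def column_def)
  have "prob ?R \<le> exp (n * (\<beta> - t * \<delta>))"
    unfolding \<beta>_def by (rule sum_tail_part_deviation)
      (use row_column(1,3) t card_le(1) disj(1) in blast)+
  moreover have "prob ?C \<le> exp (n * (\<beta> - t * \<delta>))"
    unfolding \<beta>_def by (rule sum_tail_part_deviation)
      (use row_column(2,4) t card_le(2) disj(2) in blast)+
  moreover have "prob ?H \<le> (L * (\<Sum>a\<le>L. (n * p) ^ a))\<^sup>2 / (\<theta> * (real n)\<^sup>2)"
    using \<theta> n by (intro prob_shape_hits) auto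
  moreover have "prob (failure a \<delta> \<theta> L) \<le> prob ?R + prob ?C + prob ?H"
    unfolding failure_def using failure_events
    by (intro order_trans[OF measure_Un_le] add_right_mono measure_Un_le) auto
  ultimately show ?thesis by linarith
qed

text \<open>A deterministic estimate off the failure event. The row and column tail sums, each below
  \<open>\<delta> * n\<close>, yield \<open>20 / \<eta> * \<delta> * n\<close>, and
  \<open>card_delocalized_ge\<close> converts bad vertices into lost eigenvectors.\<close>

lemma delocalized_lower_bound:
  fixes A :: "'w \<Rightarrow> real mat" and d :: nat and q \<eta> \<epsilon> \<delta> \<theta> :: real
  assumes A: "erdos_renyi_adj M n p A" and X: "X = (\<lambda>e \<omega>. A \<omega> $$ e)"
    and q: "0 < q" "n * p = q\<^sup>2" and \<eta>: "0 < \<eta>" "\<eta> \<le> 1" "\<eta> * d \<le> 1" "1 \<le> \<eta> * q\<^sup>2"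
    and \<epsilon>: "0 < \<epsilon>" "24 < \<epsilon>\<^sup>2 * d" "32 * \<eta> * d \<le> \<epsilon>\<^sup>2" "4 * \<eta> * d \<le> \<epsilon>"
    and n: "2 \<le> \<eta> * n" and \<theta>: "0 \<le> \<theta>"
  defines "L \<equiv> 2 * d + 2"
  assumes \<omega>: "\<omega> \<in> space M - failure (\<eta> * q\<^sup>2 / 4) \<delta> \<theta> L" and u: "ordered_eigenbasis n (A \<omega>) u"
  shows "real n - (L * (2 * q\<^sup>2) ^ L * (20 / \<eta> * \<delta> * n) + real L * L * (2 * q\<^sup>2) ^ L + sqrt \<theta> * n) / \<epsilon>\<^sup>2
    \<le> card (delocalized n \<epsilon> u)"
proof -
  have sp: "\<omega> \<in> space M" using \<omega> by simp
  have H: "A \<omega> \<in> carrier_mat n n"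
    and H01: "\<And>i j. i < n \<Longrightarrow> j < n \<Longrightarrow> A \<omega> $$ (i, j) \<in> {0, 1} \<and> A \<omega> $$ (i, j) = A \<omega> $$ (j, i)"
    and H0: "\<And>i. i < n \<Longrightarrow> A \<omega> $$ (i, i) = 0"
    using A sp by (auto simp: erdos_renyi_adj_def)
  have entry: "A \<omega> $$ (v, y) = (if y \<in> nbrs \<omega> v then 1 else 0)" if "v < n" "y < n" for v y
  proof (cases "v = y")
    case False
    have "A \<omega> $$ (edge_index v y) = A \<omega> $$ (v, y)"
      using H01[OF that] by (auto simp: edge_index_def max_def min_def)
    moreover have "X e \<omega> = A \<omega> $$ e" for e by (simp add: X)
    ultimately show ?thesis using False that H01[OF that] by (auto simp: nbrs_def)
  qed (use H0 that in \<open>auto simp: nbrs_def\<close>)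
  have eigen: "(\<Sum>y\<in>nbrs \<omega> v. u i $ y) = eig i (A \<omega>) * u i $ v" if v: "v \<in> {..<n}" and i: "i \<in> {1..n}" for v i
  proof -
    have ui: "u i \<in> carrier_vec n" by (rule ordered_eigenbasis_carrier[OF u H i])
    have "(\<Sum>y\<in>nbrs \<omega> v. u i $ y) = (\<Sum>y\<in>{0..<n}. if y \<in> nbrs \<omega> v then u i $ y else 0)"
      by (subst sum.inter_restrict[symmetric]) (auto simp: nbrs_def intro!: sum.cong)
    also have "\<dots> = (\<Sum>y\<in>{0..<n}. A \<omega> $$ (v, y) * u i $ y)"
      using v by (intro sum.cong) (auto simp: entry)
    also have "\<dots> = (A \<omega> *\<^sub>v u i) $ v" using v H ui by (simp add: scalar_prod_def)
    also have "A \<omega> *\<^sub>v u i = eig i (A \<omega>) \<cdot>\<^sub>v u i"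
      using u i by (auto simp: ordered_eigenbasis_def eigenvector_def)
    finally show ?thesis using v ui by simp
  qed
  have unit: "(\<Sum>v<n. (u i $ v)\<^sup>2) \<le> 1" if i: "i \<in> {1..n}" for i
  proof -
    have "u i \<bullet> u i = 1" using u i by (auto simp: ordered_eigenbasis_def orthonormal_basis_def)
    then show ?thesis using ordered_eigenbasis_carrier[OF u H i]
      by (simp add: scalar_prod_def power2_eq_square lessThan_atLeast0)
  qed
  obtain Bad where Bad: "Bad \<subseteq> {..<n}"
    and card: "card Bad \<le> L * (2 * q\<^sup>2) ^ L * (\<Sum>v\<in>{..<n} - G.typical \<omega> q \<eta>. real (card (nbrs \<omega> v) + 1))
      + real L * L * (2 * q\<^sup>2) ^ L + sqrt (card (G.lollipop_pairs \<omega> L))"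
    and small: "\<And>k (w :: nat \<Rightarrow> real) \<Lambda>. k \<in> {..<n} - Bad \<Longrightarrow>
      \<forall>v\<in>{..<n}. (\<Sum>y\<in>nbrs \<omega> v. w y) = \<Lambda> * w v \<Longrightarrow> (\<Sum>v\<in>{..<n}. (w v)\<^sup>2) \<le> 1 \<Longrightarrow> \<bar>w k\<bar> < \<epsilon>"
  proof (rule G.card_large_coordinates[OF q(1) \<eta> \<epsilon>, of \<omega>, folded L_def])
    fix Bad assume Bad: "Bad \<subseteq> {..<n}" "real (card Bad)
        \<le> L * (2 * q\<^sup>2) ^ L * (\<Sum>v\<in>{..<n} - G.typical \<omega> q \<eta>. real (card (nbrs \<omega> v) + 1))
          + real L * L * (2 * q\<^sup>2) ^ L + sqrt (card (G.lollipop_pairs \<omega> L))"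
      and small: "\<And>k (w :: nat \<Rightarrow> real) \<Lambda>. k \<in> {..<n} - Bad \<Longrightarrow>
        \<forall>v\<in>{..<n}. (\<Sum>y\<in>nbrs \<omega> v. w y) = \<Lambda> * w v \<Longrightarrow> (\<Sum>v\<in>{..<n}. (w v)\<^sup>2) \<le> 1 \<Longrightarrow> \<bar>w k\<bar> < \<epsilon>"
    show thesis by (rule that[OF Bad]) (rule small)
  qed
  define D where "D = L * (2 * q\<^sup>2) ^ L"
  have D: "0 \<le> D" by (simp add: D_def)
  have "(\<Sum>v\<in>{..<n} - G.typical \<omega> q \<eta>. real (card (nbrs \<omega> v) + 1)) \<le> 10 / \<eta> * (\<delta> * n + \<delta> * n)"
    using \<omega> \<eta> sp by (intro order_trans[OF atypical_degree_sum[OF sp q(2) \<eta>(1,2,4) n]] mult_left_mono add_mono)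
      (auto simp: failure_def)
  then have 1: "D * (\<Sum>v\<in>{..<n} - G.typical \<omega> q \<eta>. real (card (nbrs \<omega> v) + 1)) \<le> D * (20 / \<eta> * \<delta> * n)"
    using D by (intro mult_left_mono) (auto simp: algebra_simps)
  have "real (card (G.lollipop_pairs \<omega> L)) \<le> \<theta> * (real n)\<^sup>2"
    using \<omega> sp card_lollipop_pairs_le[OF sp, of L] by (auto simp: failure_def)
  then have 2: "sqrt (card (G.lollipop_pairs \<omega> L)) \<le> sqrt \<theta> * n"
    using real_sqrt_le_mono by (fastforce simp: real_sqrt_mult)
  have "card Bad \<le> D * (20 / \<eta> * \<delta> * n) + real L * L * (2 * q\<^sup>2) ^ L + sqrt \<theta> * n"
    using card 1 2 unfolding D_def[symmetric] by linarith
  then have "card Bad / \<epsilon>\<^sup>2 \<le> (D * (20 / \<eta> * \<delta> * n) + real L * L * (2 * q\<^sup>2) ^ L + sqrt \<theta> * n) / \<epsilon>\<^sup>2"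
    by (intro divide_right_mono) auto
  moreover have "real n - card Bad / \<epsilon>\<^sup>2 \<le> card (delocalized n \<epsilon> u)"
    by (rule card_delocalized_ge[OF u H Bad \<epsilon>(1)]) (rule small[OF _ _ unit], use eigen in auto)
  ultimately show ?thesis unfolding D_def by linarith
qed

end

section \<open>Borel-Cantelli for a fixed average degree and decay of the exceptional
  density\<close>

lemma random_graph_erdos_renyi:
  assumes "prob_space P" "erdos_renyi_adj P n p A" "0 \<le> p" "p \<le> 1"
  shows "random_graph P (\<lambda>e \<omega>. A \<omega> $$ e) n p"
proof -
  interpret prob_space P by fact
  show ?thesis
  proof
    fix e \<omega> assume e: "e \<in> {(i, j). j < i \<and> i < n}"
    then obtain i j where ij: "e = (i, j)" "j < i" "i < n" by auto
    show "A \<omega> $$ e \<in> {0, 1}" if "\<omega> \<in> space P"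
      using assms(2) ij that by (simp add: erdos_renyi_adj_def)
    have "\<forall>i<n. \<forall>j<i. prob {\<omega>\<in>space P. A \<omega> $$ (i, j) = 1} = p \<and> prob {\<omega>\<in>space P. A \<omega> $$ (i, j) = 0} = 1 - p"
      using assms(2) by (simp add: erdos_renyi_adj_def)
    then show "prob {\<omega> \<in> space P. A \<omega> $$ e = 1} = p" "prob {\<omega> \<in> space P. A \<omega> $$ e = 0} = 1 - p"
      using ij by auto
  qed (use assms in \<open>simp_all add: erdos_renyi_adj_def\<close>)
qed

text \<open>Nothing is assumed on how the events for different \<open>n\<close> are related, as an
  arbitrary coupling of the graphs requires.\<close>

lemma (in prob_space) AE_eventually_not_in:
  assumes ev: "\<And>n. A n \<in> events" and le: "eventually (\<lambda>n. prob (A n) \<le> f n) sequentially" and "summable f"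
  shows "AE \<omega> in M. eventually (\<lambda>n. \<omega> \<in> space M - A n) sequentially"
proof (rule borel_cantelli_AE1)
  show "summable (\<lambda>n. prob (A n))"
    by (rule summable_comparison_test_ev[OF _ assms(3)]) (use le in \<open>auto elim: eventually_mono\<close>)
qed (use ev in \<open>auto simp: less_top[symmetric]\<close>)

text \<open>It bounds the limiting proportion of bad vertices: the factor with \<open>exp\<close> is
  the \<open>\<delta>\<close> and \<open>1 / lam\<close> is the \<open>sqrt \<theta>\<close> chosen
  in \<open>delocalized_density_fixed_lambda\<close>.\<close>

definition exceptional_density :: "real \<Rightarrow> nat \<Rightarrow> real \<Rightarrow> real" where
  "exceptional_density \<eta> L lam =
     L * (2 * lam) ^ L * (20 / \<eta> * (128 / \<eta> * exp (- (\<eta>\<^sup>2 / 256) * lam))) + 1 / lam"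

text \<open>The power \<open>(2 * lam) ^ L\<close> from the ball sizes loses against the Chernoff
  exponential, because \<open>\<eta>\<close> and \<open>L\<close> stay fixed while
  \<open>lam\<close> grows.\<close>

lemma exceptional_density_tendsto_0:
  assumes "0 < \<eta>"
  shows "(exceptional_density \<eta> L \<longlongrightarrow> 0) at_top"
proof -
  define c where "c = \<eta>\<^sup>2 / 256"
  have c: "0 < c" using assms by (simp add: c_def)
  have "((\<lambda>x. (c * x) ^ L / exp (c * x)) \<longlongrightarrow> 0) at_top"
    by (rule filterlim_compose[OF tendsto_power_div_exp_0])
      (use c in \<open>auto intro!: filterlim_tendsto_pos_mult_at_top[OF tendsto_const] filterlim_ident\<close>)
  then have "((\<lambda>x. L * (2 / c) ^ L * (20 / \<eta> * (128 / \<eta>)) * ((c * x) ^ L / exp (c * x)) + 1 / x) \<longlongrightarrow>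
      L * (2 / c) ^ L * (20 / \<eta> * (128 / \<eta>)) * 0 + 0) at_top"
    by (intro tendsto_intros tendsto_divide_0[OF tendsto_const] filterlim_at_top_imp_at_infinity filterlim_ident)
  moreover have eq: "L * (2 / c) ^ L * (20 / \<eta> * (128 / \<eta>)) * ((c * x) ^ L / exp (c * x)) + 1 / x = exceptional_density \<eta> L x" for x
  proof -
    have "2 / c * (c * x) = 2 * x" using c by simp
    then have eq: "(2 / c) ^ L * (c * x) ^ L = (2 * x) ^ L" by (metis power_mult_distrib)
    have regroup: "l * a * K * (b / e) = l * (a * b) * (K / e)" for l a K b e :: real by simp
    have "20 / \<eta> * (128 / \<eta> * exp (- c * x)) = 20 / \<eta> * (128 / \<eta>) / exp (c * x)"
      by (simp add: exp_minus inverse_eq_divide)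
    then show ?thesis unfolding exceptional_density_def c_def[symmetric] regroup eq by simp
  qed
  ultimately show ?thesis unfolding eq by simp
qed

lemma exp_decay_summable: "0 < b \<Longrightarrow> summable (\<lambda>n. exp (- b * real n))"
proof -
  assume "0 < b"
  then have "summable (\<lambda>n. exp (- b) ^ n)" by (intro summable_geometric) simp
  then show ?thesis by (simp add: exp_of_nat_mult[symmetric] mult.commute)
qed

proposition delocalized_density_fixed_lambda:
  fixes A :: "nat \<Rightarrow> 'w \<Rightarrow> real mat" and d :: nat and lam \<eta> \<epsilon> :: real
  assumes "prob_space P" and A: "\<And>n. lam \<le> n \<Longrightarrow> erdos_renyi_adj P n (lam / n) (A n)"
    and u: "\<And>n \<omega>. lam \<le> n \<Longrightarrow> \<omega> \<in> space P \<Longrightarrow> ordered_eigenbasis n (A n \<omega>) (u n \<omega>)"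
    and lam: "0 < lam" and \<eta>: "0 < \<eta>" "\<eta> \<le> 1" "\<eta> * d \<le> 1" "1 \<le> \<eta> * lam"
    and \<epsilon>: "0 < \<epsilon>" "24 < \<epsilon>\<^sup>2 * d" "32 * \<eta> * d \<le> \<epsilon>\<^sup>2" "4 * \<eta> * d \<le> \<epsilon>"
  shows "AE \<omega> in P. ereal (1 - exceptional_density \<eta> (2 * d + 2) lam / \<epsilon>\<^sup>2)
    \<le> liminf (\<lambda>n. ereal (real (card (delocalized n \<epsilon> (u n \<omega>))) / real n))"
proof -
  interpret prob_space P by fact
  define L where "L = 2 * d + 2"
  define q where "q = sqrt lam"
  have q: "0 < q" "q\<^sup>2 = lam" using lam by (auto simp: q_def)
  \<comment> \<open>\<open>t\<close> minimises \<open>4 * t\<^sup>2 * lam - t * a\<close>, and the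
    minimum is the exponent in \<open>\<beta>\<close>. \<open>\<delta>\<close> is chosen to give
    \<open>\<beta> - t * \<delta> = - \<beta>\<close>, and \<open>\<theta>\<close> to give
    \<open>sqrt \<theta> = 1 / lam\<close>.\<close>
  define t where "t = \<eta> / 32"
  define \<beta> where "\<beta> = 2 * exp (- (\<eta>\<^sup>2 / 256) * lam)"
  define \<delta> where "\<delta> = 2 * \<beta> / t"
  define \<theta> where "\<theta> = 1 / lam\<^sup>2"
  define a where "a = \<eta> * q\<^sup>2 / 4"
  have pos: "0 < t" "0 < \<beta>" "0 < \<theta>" "2 * t \<le> 1" using \<eta> lam by (auto simp: t_def \<beta>_def \<theta>_def)
  have graph: "random_graph P (\<lambda>e \<omega>. A n \<omega> $$ e) n (lam / n)" if "lam \<le> n" for n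
    using that lam by (intro random_graph_erdos_renyi assms(1) A) auto
  \<comment> \<open>For \<open>n\<close> below \<open>lam\<close> the quotient
    \<open>lam / n\<close> need not be a probability; the event is set to be empty there.\<close>
  define F where "F n = (if lam \<le> n then random_graph.failure P (\<lambda>e \<omega>. A n \<omega> $$ e) n (lam / n) a \<delta> \<theta> L else {})" for n :: nat
  define f where "f n = 2 * exp (- \<beta> * n) + (L * (\<Sum>a\<le>L. lam ^ a))\<^sup>2 / \<theta> * (1 / (real n)\<^sup>2)" for n :: nat
  have large: "eventually (\<lambda>n. max lam (2 / \<eta>) \<le> real n) sequentially"
    using filterlim_real_sequentially unfolding filterlim_at_top by blast
  have "AE \<omega> in P. eventually (\<lambda>n. \<omega> \<in> space P - F n) sequentially"
  proof (rule AE_eventually_not_in)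
    show "F n \<in> events" for n
      unfolding F_def using random_graph.failure_events(4)[OF graph] by auto
    show "eventually (\<lambda>n. prob (F n) \<le> f n) sequentially"
      using large
    proof eventually_elim
      case (elim n)
      then have n: "lam \<le> n" "0 < n" using lam by auto
      have np: "n * (lam / n) = lam" using n by simp
      have "4 * t\<^sup>2 * lam - t * a = - (\<eta>\<^sup>2 / 256) * lam"
        using q(2) by (simp add: t_def a_def power2_eq_square field_simps)
      then have b: "2 * exp (4 * t\<^sup>2 * lam - t * a) = \<beta>" by (simp add: \<beta>_def)
      have td: "\<beta> - t * \<delta> = - \<beta>" using pos by (simp add: \<delta>_def)
      have "prob (F n) \<le> 2 * exp (n * (\<beta> - t * \<delta>)) + (L * (\<Sum>a\<le>L. lam ^ a))\<^sup>2 / (\<theta> * (real n)\<^sup>2)"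
        using random_graph.prob_failure[OF graph[OF n(1)], of t \<theta> a \<delta> L] n pos unfolding np b
        by (simp add: F_def)
      also have "\<dots> = f n" unfolding td by (simp add: f_def mult.commute)
      finally show ?case .
    qed
    show "summable f"
      unfolding f_def using exp_decay_summable[OF pos(2)] inverse_power_summable[of 2, where ?'a = real]
      by (intro summable_add summable_mult) (auto simp: divide_inverse)
  qed
  then show ?thesis
  proof (rule AE_mp, intro AE_I2 impI)
    fix \<omega> assume sp: "\<omega> \<in> space P" and good: "eventually (\<lambda>n. \<omega> \<in> space P - F n) sequentially"
    \<comment> \<open>\<open>C\<close> collects the term that does not grow with \<open>n\<close>
      and vanishes after division by \<open>n\<close>.\<close>
    define C where "C = real L * L * (2 * lam) ^ L / \<epsilon>\<^sup>2"
    define \<kappa> where "\<kappa> = exceptional_density \<eta> L lam"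
    have "eventually (\<lambda>n. ereal (1 - \<kappa> / \<epsilon>\<^sup>2 - C * (1 / n)) \<le> ereal (real (card (delocalized n \<epsilon> (u n \<omega>))) / real n)) sequentially"
      using large good
    proof eventually_elim
      case (elim n)
      then have n: "lam \<le> n" "0 < n" "2 \<le> \<eta> * n" using lam \<eta> by (auto simp: field_simps)
      have np: "n * (lam / n) = q\<^sup>2" using n q by simp
      have "real n - (L * (2 * q\<^sup>2) ^ L * (20 / \<eta> * \<delta> * n) + real L * L * (2 * q\<^sup>2) ^ L + sqrt \<theta> * n) / \<epsilon>\<^sup>2
          \<le> card (delocalized n \<epsilon> (u n \<omega>))"
        unfolding L_def
        by (rule random_graph.delocalized_lower_bound[OF graph[OF n(1)] A[OF n(1)] refl q(1) np \<eta>(1-3) _ \<epsilon> n(3)])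
          (use elim n pos \<eta> q sp u in \<open>auto simp: F_def a_def L_def\<close>)
      moreover have "sqrt \<theta> = 1 / lam" using lam by (simp add: \<theta>_def real_sqrt_divide)
      moreover have "\<delta> = 128 / \<eta> * exp (- (\<eta>\<^sup>2 / 256) * lam)" by (simp add: \<delta>_def t_def \<beta>_def)
      ultimately have "real n - (\<kappa> * n + real L * L * (2 * lam) ^ L) / \<epsilon>\<^sup>2 \<le> card (delocalized n \<epsilon> (u n \<omega>))"
        by (simp add: \<kappa>_def exceptional_density_def q(2) algebra_simps)
      then have "(real n - (\<kappa> * n + real L * L * (2 * lam) ^ L) / \<epsilon>\<^sup>2) / n \<le> card (delocalized n \<epsilon> (u n \<omega>)) / n"
        by (intro divide_right_mono) auto
      also have "(real n - (\<kappa> * n + real L * L * (2 * lam) ^ L) / \<epsilon>\<^sup>2) / n = 1 - \<kappa> / \<epsilon>\<^sup>2 - C * (1 / n)"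
        using n by (simp add: C_def add_divide_distrib diff_divide_distrib)
      finally show ?case by simp
    qed
    then have "liminf (\<lambda>n. ereal (1 - \<kappa> / \<epsilon>\<^sup>2 - C * (1 / real n)))
        \<le> liminf (\<lambda>n. ereal (real (card (delocalized n \<epsilon> (u n \<omega>))) / real n))"
      by (rule Liminf_mono)
    moreover have lim: "(\<lambda>n. ereal (1 - \<kappa> / \<epsilon>\<^sup>2 - C * (1 / real n))) \<longlonglongrightarrow> ereal (1 - \<kappa> / \<epsilon>\<^sup>2 - C * 0)"
      by (intro tendsto_ereal tendsto_intros lim_1_over_n)
    have "liminf (\<lambda>n. ereal (1 - \<kappa> / \<epsilon>\<^sup>2 - C * (1 / real n))) = ereal (1 - \<kappa> / \<epsilon>\<^sup>2)"
      unfolding lim_imp_Liminf[OF sequentially_bot lim] by simp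
    ultimately show "ereal (1 - exceptional_density \<eta> (2 * d + 2) lam / \<epsilon>\<^sup>2)
        \<le> liminf (\<lambda>n. ereal (real (card (delocalized n \<epsilon> (u n \<omega>))) / real n))"
      by (simp add: \<kappa>_def L_def)
  qed
qed

text \<open>\<open>A\<close> has finitely many values, each taken on a measurable event, so
  \<open>h\<close> may be arbitrary, even the coordinate of an eigenvector selected by
  choice.\<close>

lemma adjacency_matrix_measurable:
  fixes h :: "real mat \<Rightarrow> real"
  assumes "prob_space P" and A: "erdos_renyi_adj P n p A"
  shows "(\<lambda>\<omega>. h (A \<omega>)) \<in> borel_measurable P"
proof -
  interpret prob_space P by fact
  define Mats where "Mats = A ` space P"
  have mat: "A \<omega> \<in> carrier_mat n n" "\<And>i. i < n \<Longrightarrow> A \<omega> $$ (i, i) = 0"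
      "\<And>i j. i < n \<Longrightarrow> j < n \<Longrightarrow> A \<omega> $$ (i, j) \<in> {0, 1} \<and> A \<omega> $$ (i, j) = A \<omega> $$ (j, i)" if "\<omega> \<in> space P" for \<omega>
    using A that by (auto simp: erdos_renyi_adj_def)
  have "Mats \<subseteq> (\<lambda>f. mat n n f) ` (({..<n} \<times> {..<n}) \<rightarrow>\<^sub>E {0, 1})"
  proof
    fix H assume "H \<in> Mats"
    then obtain \<omega> where \<omega>: "\<omega> \<in> space P" "H = A \<omega>" by (auto simp: Mats_def)
    have "H = mat n n (restrict (\<lambda>ij. H $$ ij) ({..<n} \<times> {..<n}))"
      using mat(1)[OF \<omega>(1)] \<omega>(2) by (intro eq_matI) auto
    moreover have "restrict (\<lambda>ij. H $$ ij) ({..<n} \<times> {..<n}) \<in> ({..<n} \<times> {..<n}) \<rightarrow>\<^sub>E {0, 1}"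
      using mat(3)[OF \<omega>(1)] \<omega>(2) by auto
    ultimately show "H \<in> (\<lambda>f. mat n n f) ` (({..<n} \<times> {..<n}) \<rightarrow>\<^sub>E {0, 1})" by blast
  qed
  then have fin: "finite Mats" by (rule finite_subset) (auto intro!: finite_imageI finite_PiE)
  have low: "(\<lambda>\<omega>. A \<omega> $$ (i, j)) \<in> borel_measurable P" if "j < i" "i < n" for i j
    using A that by (auto simp: erdos_renyi_adj_def indep_vars_def)
  have entry: "(\<lambda>\<omega>. A \<omega> $$ (i, j)) \<in> borel_measurable P" if ij: "i < n" "j < n" for i j
  proof -
    consider "i = j" | "j < i" | "i < j" by linarith
    then show ?thesis
    proof cases
      case 1
      then show ?thesis using mat(2) ij by (subst measurable_cong[of _ _ "\<lambda>_. 0"]) auto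
    next
      case 3
      then show ?thesis using mat(3) ij low[of i j]
        by (subst measurable_cong[of _ _ "\<lambda>\<omega>. A \<omega> $$ (j, i)"]) auto
    qed (use low ij in auto)
  qed
  have "A \<in> measurable P (count_space Mats)"
  proof (rule measurable_count_space_eq2[THEN iffD2, OF fin], intro conjI ballI)
    show "A \<in> space P \<rightarrow> Mats" by (auto simp: Mats_def)
    fix H assume "H \<in> Mats"
    then have H: "H \<in> carrier_mat n n" using mat by (auto simp: Mats_def)
    have "A -` {H} \<inter> space P = {\<omega>\<in>space P. \<forall>i\<in>{..<n}. \<forall>j\<in>{..<n}. A \<omega> $$ (i, j) = H $$ (i, j)}"
      using H by (auto intro!: eq_matI simp: carrier_matD[OF mat(1)])
    also have "\<dots> \<in> events"
      using entry by (intro sets.sets_Collect_finite_All borel_measurable_eq) auto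
    finally show "A -` {H} \<inter> space P \<in> events" .
  qed
  then show ?thesis by (rule measurable_compose) simp
qed

theorem theorem1p2:
  fixes P :: "'w measure"
    and M :: "nat \<Rightarrow> real \<Rightarrow> 'w \<Rightarrow> real mat"
    and \<epsilon> :: real
  assumes "prob_space P"
    and "\<And>n p. 0 \<le> p \<Longrightarrow> p \<le> 1 \<Longrightarrow> erdos_renyi_adj P n p (M n p)"
    and "\<epsilon> > 0"
  shows "\<exists>u :: real \<Rightarrow> nat \<Rightarrow> 'w \<Rightarrow> nat \<Rightarrow> real vec.
    (\<forall>lam n. 0 < lam \<longrightarrow> lam \<le> real n \<longrightarrow>
       random_ordered_eigenbasis P n (M n (lam / real n)) (u lam n)) \<and>
    (\<forall>lam :: nat \<Rightarrow> real. (\<forall>m. 0 < lam m) \<longrightarrow> filterlim lam at_top sequentially \<longrightarrow>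
       (AE \<omega> in P. liminf (\<lambda>m. liminf (\<lambda>n.
          ereal (real (card (delocalized n \<epsilon> (u (lam m) n \<omega>))) / real n))) = 1))"
proof -
  \<comment> \<open>The basis is selected as a function of the matrix alone, so that
    \<open>adjacency_matrix_measurable\<close> makes it random in the required sense.\<close>
  define U where "U n H = (SOME u. ordered_eigenbasis n H u)" for n and H :: "real mat"
  define u where "u lam n \<omega> = U n (M n (lam / real n) \<omega>)" for lam n \<omega>
  have adj: "erdos_renyi_adj P n (lam / n) (M n (lam / n))" if "0 < lam" "lam \<le> n" for lam :: real and n :: nat
    using that by (intro assms(2)) auto
  have basis: "ordered_eigenbasis n (M n (lam / n) \<omega>) (u lam n \<omega>)"
    if "0 < lam" "lam \<le> n" "\<omega> \<in> space P" for lam :: real and n :: nat and \<omega>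
  proof -
    have H: "M n (lam / n) \<omega> \<in> carrier_mat n n"
      and sym: "\<And>i j. i < n \<Longrightarrow> j < n \<Longrightarrow> M n (lam / n) \<omega> $$ (i, j) = M n (lam / n) \<omega> $$ (j, i)"
      using adj[OF that(1,2)] that(3) by (auto simp: erdos_renyi_adj_def)
    have "transpose_mat (M n (lam / n) \<omega>) = M n (lam / n) \<omega>"
      using H by (intro eq_matI) (auto simp: sym)
    from ordered_eigenbasis_exists[OF H this] show ?thesis
      unfolding u_def U_def by (rule someI_ex)
  qed
  have "random_ordered_eigenbasis P n (M n (lam / n)) (u lam n)" if "0 < lam" "lam \<le> n" for lam :: real and n :: nat
    unfolding random_ordered_eigenbasis_def
  proof (intro conjI ballI allI impI)
    show "(\<lambda>\<omega>. u lam n \<omega> i $ k) \<in> borel_measurable P" for i k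
      unfolding u_def
      by (rule adjacency_matrix_measurable[OF assms(1) adj[OF that], of "\<lambda>H. U n H i $ k"])
  qed (use basis that in auto)
  moreover have "AE \<omega> in P. liminf (\<lambda>m. liminf (\<lambda>n.
          ereal (real (card (delocalized n \<epsilon> (u (lam m) n \<omega>))) / real n))) = 1"
    if pos: "\<forall>m. 0 < lam m" and lim: "filterlim lam at_top sequentially" for lam :: "nat \<Rightarrow> real"
  proof -
    \<comment> \<open>\<open>d\<close> exceeds \<open>24 / \<epsilon>\<^sup>2\<close>, and
      \<open>\<eta>\<close> meets the three upper bounds of \<open>coordinate_small\<close> and its
      locale. Both depend on \<open>\<epsilon>\<close> only, so \<open>lam\<close> may tend to
      infinity afterwards.\<close>
    define d where "d = nat \<lceil>24 / \<epsilon>\<^sup>2\<rceil> + 1"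
    define \<eta> where "\<eta> = min (1 / d) (min (\<epsilon>\<^sup>2 / (32 * d)) (\<epsilon> / (4 * d)))"
    have d: "0 < d" by (simp add: d_def)
    have \<eta>: "0 < \<eta>" "\<eta> \<le> 1 / d" "\<eta> \<le> \<epsilon>\<^sup>2 / (32 * d)" "\<eta> \<le> \<epsilon> / (4 * d)"
      using d assms(3) by (auto simp: \<eta>_def)
    have "24 / \<epsilon>\<^sup>2 < d" unfolding d_def by linarith
    then have \<epsilon>: "24 < \<epsilon>\<^sup>2 * d" "32 * \<eta> * d \<le> \<epsilon>\<^sup>2" "4 * \<eta> * d \<le> \<epsilon>" "\<eta> * d \<le> 1"
      using \<eta> d assms(3) by (auto simp: field_simps)
    have "1 / real d \<le> 1" using d by simp
    then have "\<eta> \<le> 1" using \<eta>(2) by linarith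
    define \<kappa> where "\<kappa> lam = exceptional_density \<eta> (2 * d + 2) lam" for lam
    define x where "x m \<omega> = liminf (\<lambda>n. ereal (real (card (delocalized n \<epsilon> (u (lam m) n \<omega>))) / real n))" for m \<omega>
    \<comment> \<open>The guard holds for all large \<open>m\<close>; keeping it as an implication
      allows one null set for all \<open>m\<close>.\<close>
    have "AE \<omega> in P. 1 \<le> \<eta> * lam m \<longrightarrow> ereal (1 - \<kappa> (lam m) / \<epsilon>\<^sup>2) \<le> x m \<omega>" for m
    proof (cases "1 \<le> \<eta> * lam m")
      case True
      then show ?thesis
        using delocalized_density_fixed_lambda[OF assms(1) adj basis _ \<eta>(1) \<open>\<eta> \<le> 1\<close> \<epsilon>(4) True assms(3) \<epsilon>(1-3)] pos
        by (simp add: \<kappa>_def x_def)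
    qed simp
    then have "AE \<omega> in P. \<forall>m. 1 \<le> \<eta> * lam m \<longrightarrow> ereal (1 - \<kappa> (lam m) / \<epsilon>\<^sup>2) \<le> x m \<omega>"
      by (simp add: AE_all_countable)
    then show ?thesis
    proof (rule AE_mp, intro AE_I2 impI)
      fix \<omega> assume *: "\<forall>m. 1 \<le> \<eta> * lam m \<longrightarrow> ereal (1 - \<kappa> (lam m) / \<epsilon>\<^sup>2) \<le> x m \<omega>"
      have "eventually (\<lambda>m. 1 / \<eta> \<le> lam m) sequentially" using lim unfolding filterlim_at_top by blast
      then have "eventually (\<lambda>m. ereal (1 - \<kappa> (lam m) / \<epsilon>\<^sup>2) \<le> x m \<omega>) sequentially"
        by eventually_elim (use * \<eta>(1) in \<open>auto simp: field_simps\<close>)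
      then have "liminf (\<lambda>m. ereal (1 - \<kappa> (lam m) / \<epsilon>\<^sup>2)) \<le> liminf (\<lambda>m. x m \<omega>)" by (rule Liminf_mono)
      moreover have lim1: "(\<lambda>m. ereal (1 - \<kappa> (lam m) / \<epsilon>\<^sup>2)) \<longlonglongrightarrow> ereal (1 - 0 / \<epsilon>\<^sup>2)"
        unfolding \<kappa>_def using assms(3)
        by (intro tendsto_ereal tendsto_intros filterlim_compose[OF exceptional_density_tendsto_0[OF \<eta>(1)] lim]) auto
      have "liminf (\<lambda>m. ereal (1 - \<kappa> (lam m) / \<epsilon>\<^sup>2)) = 1"
        unfolding lim_imp_Liminf[OF sequentially_bot lim1] by (simp add: one_ereal_def)
      ultimately have "1 \<le> liminf (\<lambda>m. x m \<omega>)" by simp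
      \<comment> \<open>For the upper bound, each proportion is at most 1, including
        \<open>n = 0\<close>, where the quotient is 0 by convention.\<close>
      moreover have "x m \<omega> \<le> 1" for m
      proof -
        have "ereal (real (card (delocalized n \<epsilon> (u (lam m) n \<omega>))) / real n) \<le> 1" for n
        proof -
          have "card (delocalized n \<epsilon> (u (lam m) n \<omega>)) \<le> card {1..n}"
            by (intro card_mono) (auto simp: delocalized_def)
          then have "real (card (delocalized n \<epsilon> (u (lam m) n \<omega>))) / real n \<le> 1"
            by (auto simp: divide_le_eq_1)
          then show ?thesis by (simp add: one_ereal_def)
        qed
        then have "x m \<omega> \<le> liminf (\<lambda>n :: nat. 1 :: ereal)" unfolding x_def by (intro Liminf_mono) auto
        then show ?thesis by (simp add: Liminf_const)
      qed
      then have "liminf (\<lambda>m. x m \<omega>) \<le> liminf (\<lambda>n :: nat. 1 :: ereal)" by (intro Liminf_mono) auto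
      then have "liminf (\<lambda>m. x m \<omega>) \<le> 1" by (simp add: Liminf_const)
      ultimately show "liminf (\<lambda>m. liminf (\<lambda>n.
          ereal (real (card (delocalized n \<epsilon> (u (lam m) n \<omega>))) / real n))) = 1"
        by (simp add: x_def antisym)
    qed
  qed
  ultimately show ?thesis by blast
qed

end
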